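(* The algebra $\mathbf{Baxter}$ is free (as a unital associative algebra) on the elements $\mathbf{E}_J$ (resp. $\mathbf{H}_J$) such that $J$ is a non-empty connected (resp. anti-connected) pair of twin binary trees.
   Context: $\mathbb{K}$ is a field of characteristic zero. $\mathfrak{S}$ is the set of all permutations (of all sizes $n\ge0$), seen as words; $\mathrm{std}(u)$ is the unique permutation of size $|u|$ with the same inversions as $u$. $\mathbf{FQSym}$ is the Hopf algebra over $\mathbb{K}$ with basis $\{\mathbf{F}_\sigma\}_{\sigma\in\mathfrak{S}}$, product $\mathbf{F}_\sigma\cdot\mathbf{F}_\nu = \sum_{\pi} \mathbf{F}_\pi$, where $\pi$ runs over all shuffles of $\sigma$ with the word obtained by adding $|\sigma|$ to every letter of $\nu$, and coproduct $\Delta(\mathbf{F}_\sigma) = \sum_{\sigma = uv} \mathbf{F}_{\mathrm{std}(u)} \otimes \mathbf{F}_{\mathrm{std}(v)}$. A binary tree is either a leaf (empty tree) or a node with a left and a right binary subtree. The canopy of a binary tree with $n$ nodes is the word of length $n-1$ obtained by reading its leaves from left to right except the first and the last, writing $0$ if the leaf is a right child and $1$ if it is a left child. A pair of twin binary trees is a pair of binary trees with the same number $n$ of nodes whose canopies differ at every position $1\le i\le n-1$. For a permutation $\sigma$, $\mathsf{P}(\sigma) = (T_L,T_R)$ where $T_L$ (resp. $T_R$) is the shape of the binary search tree obtained by inserting the letters of $\sigma$ from left to right (resp. right to left) with the standard binary search tree leaf insertion. $\mathbf{Baxter}$ is the Hopf subalgebra of $\mathbf{FQSym}$ with basis $\{\mathbf{P}_J\}$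 indexed by pairs of twin binary trees, where $\mathbf{P}_J = \sum_{\sigma\in\mathfrak{S},\ \mathsf{P}(\sigma) = J} \mathbf{F}_\sigma$. The permutohedron order $\leq_{\mathrm{P}}$ on permutations of size $n$ is the partial order in which $\sigma$ is covered by $\nu$ iff $\sigma = u\,ab\,v$ and $\nu = u\,ba\,v$ for some words $u,v$ and letters $a<b$. The Baxter order on pairs of twin binary trees with $n$ nodes is defined by $J_0 \leq_{\mathrm{B}} J_1$ iff there are permutations $\sigma \leq_{\mathrm{P}} \nu$ of size $n$ with $\mathsf{P}(\sigma) = J_0$ and $\mathsf{P}(\nu) = J_1$. The elementary and homogeneous families of $\mathbf{Baxter}$ are $\mathbf{E}_J := \sum_{J \leq_{\mathrm{B}} J'} \mathbf{P}_{J'}$ and $\mathbf{H}_J := \sum_{J' \leq_{\mathrm{B}} J} \mathbf{P}_{J'}$. For permutations $\sigma,\nu$, $\sigma / \nu$ is the concatenation of $\sigma$ with the letters of $\nu$ incremented by $|\sigma|$. A permutation $\sigma$ is connected if $\sigma = \nu / \pi$ implies $\nu = \sigma$ or $\pi = \sigma$; it is anti-connected if its mirror image $\sigma_n \cdots \sigma_1$ is connected. A pair of twin binary trees $J$ is connected (resp. anti-connected) if all permutations $\sigma$ such that $\mathsf{P}(\sigma) = J$ are connected (resp. anti-connected). *)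

theory Defs
  imports Complex_Main "HOL-Library.Poly_Mapping" "HOL-Library.Tree"
begin

section \<open>Permutations as words\<close>

definition perms :: "nat list set" where
  "perms = {\<sigma>. distinct \<sigma> \<and> set \<sigma> = {1..length \<sigma>}}"

definition shift :: "nat \<Rightarrow> nat list \<Rightarrow> nat list" where
  "shift k \<nu> = map (\<lambda>i. i + k) \<nu>"

text \<open>
  If \<open>\<sigma>\<close> and \<open>\<nu>\<close> are permutations, \<open>\<sigma>\<close> and the shifted word of \<open>\<nu>\<close> have disjoint letters, so that
  different ways of interleaving them give different words: summing over the set of the
  shuffles is the same as summing over the shuffles with multiplicities.
\<close>
definition shifted_shuffles :: "nat list \<Rightarrow> nat list \<Rightarrow> nat list set" where
  "shifted_shuffles \<sigma> \<nu> = shuffles \<sigma> (shift (length \<sigma>) \<nu>)"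

definition over :: "nat list \<Rightarrow> nat list \<Rightarrow> nat list" where
  "over \<sigma> \<nu> = \<sigma> @ shift (length \<sigma>) \<nu>"

definition connected_perm :: "nat list \<Rightarrow> bool" where
  "connected_perm \<sigma> \<longleftrightarrow>
     \<sigma> \<in> perms \<and> (\<forall>\<nu>\<in>perms. \<forall>\<pi>\<in>perms. \<sigma> = over \<nu> \<pi> \<longrightarrow> \<nu> = \<sigma> \<or> \<pi> = \<sigma>)"

definition anticonnected_perm :: "nat list \<Rightarrow> bool" where
  "anticonnected_perm \<sigma> \<longleftrightarrow> connected_perm (rev \<sigma>)"

inductive permutohedron_cover :: "nat list \<Rightarrow> nat list \<Rightarrow> bool" where
  "a < b \<Longrightarrow> permutohedron_cover (u @ [a, b] @ v) (u @ [b, a] @ v)"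

definition permutohedron_le :: "nat list \<Rightarrow> nat list \<Rightarrow> bool" where
  "permutohedron_le = permutohedron_cover\<^sup>*\<^sup>*"


section \<open>The algebra FQSym\<close>

lemma shift_shift: "shift k (shift l xs) = shift (l + k) xs"
  by (simp add: shift_def add.assoc)

lemma length_shift [simp]: "length (shift k xs) = length xs"
  by (simp add: shift_def)

lemma set_shift: "set (shift k xs) = (\<lambda>i. i + k) ` set xs"
  by (simp add: shift_def)

lemma perms_Nil [simp]: "[] \<in> perms"
  by (simp add: perms_def)

lemma perms_disjoint:
  assumes "\<sigma> \<in> perms" "\<nu> \<in> perms"
  shows "set \<sigma> \<inter> set (shift (length \<sigma>) \<nu>) = {}"
  using assms by (auto simp: perms_def set_shift)

lemma shifted_shuffles_perms:
  assumes "\<sigma> \<in> perms" "\<nu> \<in> perms" "\<pi> \<in> shifted_shuffles \<sigma> \<nu>"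
  shows "\<pi> \<in> perms"
proof -
  have \<pi>: "\<pi> \<in> shuffles \<sigma> (shift (length \<sigma>) \<nu>)"
    using assms(3) by (simp add: shifted_shuffles_def)
  have "distinct (shift (length \<sigma>) \<nu>)"
    using assms(2) by (auto simp: perms_def shift_def distinct_map inj_on_def)
  then have "distinct \<pi>"
    using distinct_disjoint_shuffles[OF _ _ perms_disjoint[OF assms(1,2)] \<pi>] assms(1)
    by (simp add: perms_def)
  moreover have "(\<lambda>i. i + length \<sigma>) ` {1..length \<nu>} = {length \<sigma> + 1..length \<sigma> + length \<nu>}"
    using image_add_atLeastAtMost[of "length \<sigma>" 1 "length \<nu>"] by (simp add: add.commute)
  then have "set \<pi> = {1..length \<pi>}"
    using set_shuffles[OF \<pi>] length_shuffles[OF \<pi>] assms(1,2)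
    by (auto simp: perms_def set_shift)
  ultimately show ?thesis by (simp add: perms_def)
qed

lemma shuffles_map_shift: "shuffles (shift k xs) (shift k ys) = shift k ` shuffles xs ys"
  unfolding shift_def
  by (induction xs ys rule: shuffles.induct) (auto simp: image_Un image_image)

lemma shuffles_assoc_aux:
  "\<tau> \<in> shuffles \<pi> c \<Longrightarrow> \<pi> \<in> shuffles a b \<Longrightarrow> \<exists>\<pi>'\<in>shuffles b c. \<tau> \<in> shuffles a \<pi>'"
proof (induction \<tau> arbitrary: \<pi> a b c)
  case Nil
  then show ?case by simp
next
  case (Cons t \<tau>)
  from Cons.prems(1) consider
      (left) \<pi>' where "\<pi> = t # \<pi>'" "\<tau> \<in> shuffles \<pi>' c"
    | (right) c' where "c = t # c'" "\<tau> \<in> shuffles \<pi> c'"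
    by (auto simp: Cons_in_shuffles_iff neq_Nil_conv)
  then show ?case
  proof cases
    case left
    with Cons.prems(2) consider
        (first) a' where "a = t # a'" "\<pi>' \<in> shuffles a' b"
      | (second) b' where "b = t # b'" "\<pi>' \<in> shuffles a b'"
      by (auto simp: Cons_in_shuffles_iff neq_Nil_conv)
    then show ?thesis
    proof cases
      case first
      obtain \<rho> where "\<rho> \<in> shuffles b c" "\<tau> \<in> shuffles a' \<rho>"
        using Cons.IH[OF left(2) first(2)] by blast
      then show ?thesis
        unfolding first(1) by (intro bexI[of _ \<rho>] Cons_in_shuffles_leftI)
    next
      case second
      obtain \<rho> where "\<rho> \<in> shuffles b' c" "\<tau> \<in> shuffles a \<rho>"
        using Cons.IH[OF left(2) second(2)] by blast
      then show ?thesis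
        unfolding second(1)
        by (intro bexI[of _ "t # \<rho>"] Cons_in_shuffles_leftI Cons_in_shuffles_rightI)
    qed
  next
    case right
    obtain \<rho> where "\<rho> \<in> shuffles b c'" "\<tau> \<in> shuffles a \<rho>"
      using Cons.IH[OF right(2) Cons.prems(2)] by blast
    then show ?thesis
      unfolding right(1) by (intro bexI[of _ "t # \<rho>"] Cons_in_shuffles_rightI)
  qed
qed

lemma shuffles_assoc:
  "(\<Union>\<pi>\<in>shuffles a b. shuffles \<pi> c) = (\<Union>\<pi>\<in>shuffles b c. shuffles a \<pi>)"
proof (intro equalityI subsetI)
  fix \<tau> assume "\<tau> \<in> (\<Union>\<pi>\<in>shuffles a b. shuffles \<pi> c)"
  then obtain \<pi> where "\<tau> \<in> shuffles \<pi> c" "\<pi> \<in> shuffles a b" by blast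
  from shuffles_assoc_aux[OF this] show "\<tau> \<in> (\<Union>\<pi>\<in>shuffles b c. shuffles a \<pi>)" by blast
next
  fix \<tau> assume "\<tau> \<in> (\<Union>\<pi>\<in>shuffles b c. shuffles a \<pi>)"
  then obtain \<pi> where "\<pi> \<in> shuffles b c" "\<tau> \<in> shuffles a \<pi>" by blast
  then have "\<tau> \<in> shuffles \<pi> a" "\<pi> \<in> shuffles c b"
    by (simp_all only: shuffles_commutes[of \<pi> a] shuffles_commutes[of c b])
  from shuffles_assoc_aux[OF this] obtain \<rho> where "\<rho> \<in> shuffles b a" "\<tau> \<in> shuffles c \<rho>" ..
  then have "\<rho> \<in> shuffles a b" "\<tau> \<in> shuffles \<rho> c"
    by (simp_all only: shuffles_commutes[of \<rho> c] shuffles_commutes[of a b])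
  then show "\<tau> \<in> (\<Union>\<pi>\<in>shuffles a b. shuffles \<pi> c)" by blast
qed

lemma sum_shifted_shuffles_assoc:
  fixes f :: "nat list \<Rightarrow> 'a::comm_monoid_add"
  assumes "\<sigma> \<in> perms" "\<nu> \<in> perms" "\<rho> \<in> perms"
  shows "(\<Sum>\<pi>\<in>shifted_shuffles \<sigma> \<nu>. \<Sum>\<tau>\<in>shifted_shuffles \<pi> \<rho>. f \<tau>) =
         (\<Sum>\<pi>\<in>shifted_shuffles \<nu> \<rho>. \<Sum>\<tau>\<in>shifted_shuffles \<sigma> \<pi>. f \<tau>)"
proof -
  define n m where "n = length \<sigma>" and "m = length \<nu>"
  define b c where "b = shift n \<nu>" and "c = shift (n + m) \<rho>"
  have dab: "set \<sigma> \<inter> set b = {}" and dac: "set \<sigma> \<inter> set c = {}" and dbc: "set b \<inter> set c = {}"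
    using assms unfolding b_def c_def n_def m_def perms_def set_shift by auto
  have "(\<Sum>\<pi>\<in>shifted_shuffles \<sigma> \<nu>. \<Sum>\<tau>\<in>shifted_shuffles \<pi> \<rho>. f \<tau>) =
        (\<Sum>\<pi>\<in>shuffles \<sigma> b. \<Sum>\<tau>\<in>shuffles \<pi> c. f \<tau>)"
    unfolding shifted_shuffles_def b_def c_def n_def m_def
    by (intro sum.cong refl) (auto dest: length_shuffles)
  also have "\<dots> = sum f (\<Union>\<pi>\<in>shuffles \<sigma> b. shuffles \<pi> c)"
  proof (rule sum.UNION_disjoint[symmetric], simp, simp, intro ballI impI)
    fix \<pi> \<pi>' assume *: "\<pi> \<in> shuffles \<sigma> b" "\<pi>' \<in> shuffles \<sigma> b" "\<pi> \<noteq> \<pi>'"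
    have d: "set \<pi> \<inter> set c = {}" "set \<pi>' \<inter> set c = {}"
      using set_shuffles[OF *(1)] set_shuffles[OF *(2)] dac dbc by auto
    have "\<pi> = \<pi>'" if "\<tau> \<in> shuffles \<pi> c" "\<tau> \<in> shuffles \<pi>' c" for \<tau>
      using filter_shuffles_disjoint2(2)[OF d(1) that(1)] filter_shuffles_disjoint2(2)[OF d(2) that(2)]
      by simp
    then show "shuffles \<pi> c \<inter> shuffles \<pi>' c = {}" using *(3) by blast
  qed
  also have "\<dots> = sum f (\<Union>\<pi>\<in>shuffles b c. shuffles \<sigma> \<pi>)"
    by (simp add: shuffles_assoc)
  also have "\<dots> = (\<Sum>\<pi>\<in>shuffles b c. \<Sum>\<tau>\<in>shuffles \<sigma> \<pi>. f \<tau>)"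
  proof (rule sum.UNION_disjoint, simp, simp, intro ballI impI)
    fix \<pi> \<pi>' assume *: "\<pi> \<in> shuffles b c" "\<pi>' \<in> shuffles b c" "\<pi> \<noteq> \<pi>'"
    have d: "set \<sigma> \<inter> set \<pi> = {}" "set \<sigma> \<inter> set \<pi>' = {}"
      using set_shuffles[OF *(1)] set_shuffles[OF *(2)] dac dab by auto
    have "\<pi> = \<pi>'" if "\<tau> \<in> shuffles \<sigma> \<pi>" "\<tau> \<in> shuffles \<sigma> \<pi>'" for \<tau>
      using filter_shuffles_disjoint1(2)[OF d(1) that(1)] filter_shuffles_disjoint1(2)[OF d(2) that(2)]
      by simp
    then show "shuffles \<sigma> \<pi> \<inter> shuffles \<sigma> \<pi>' = {}" using *(3) by blast
  qed
  also have "shuffles b c = shift n ` shifted_shuffles \<nu> \<rho>"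
    unfolding b_def c_def m_def shifted_shuffles_def
    by (simp add: shuffles_map_shift[symmetric] shift_shift add.commute)
  also have "(\<Sum>\<pi>\<in>shift n ` shifted_shuffles \<nu> \<rho>. \<Sum>\<tau>\<in>shuffles \<sigma> \<pi>. f \<tau>) =
             (\<Sum>\<pi>\<in>shifted_shuffles \<nu> \<rho>. \<Sum>\<tau>\<in>shuffles \<sigma> (shift n \<pi>). f \<tau>)"
    by (subst sum.reindex) (auto simp: shift_def inj_on_def inj_map_eq_map[of "\<lambda>i. i + n"])
  finally show ?thesis by (simp add: shifted_shuffles_def n_def)
qed

text \<open>The bilinear extension of the shifted shuffle product to arbitrary linear combinations of words.\<close>
definition shuffle_mult ::
  "(nat list \<Rightarrow>\<^sub>0 'k::comm_ring_1) \<Rightarrow> (nat list \<Rightarrow>\<^sub>0 'k) \<Rightarrow> (nat list \<Rightarrow>\<^sub>0 'k)" where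
  "shuffle_mult f g = (\<Sum>\<sigma>\<in>Poly_Mapping.keys f. \<Sum>\<nu>\<in>Poly_Mapping.keys g. \<Sum>\<pi>\<in>shifted_shuffles \<sigma> \<nu>.
     Poly_Mapping.single \<pi> (Poly_Mapping.lookup f \<sigma> * Poly_Mapping.lookup g \<nu>))"

lemma shuffle_mult_superset:
  assumes "finite A" "finite B" "Poly_Mapping.keys f \<subseteq> A" "Poly_Mapping.keys g \<subseteq> B"
  shows "shuffle_mult f g = (\<Sum>\<sigma>\<in>A. \<Sum>\<nu>\<in>B. \<Sum>\<pi>\<in>shifted_shuffles \<sigma> \<nu>.
     Poly_Mapping.single \<pi> (Poly_Mapping.lookup f \<sigma> * Poly_Mapping.lookup g \<nu>))"
proof -
  have "shuffle_mult f g = (\<Sum>\<sigma>\<in>Poly_Mapping.keys f. \<Sum>\<nu>\<in>B. \<Sum>\<pi>\<in>shifted_shuffles \<sigma> \<nu>.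
     Poly_Mapping.single \<pi> (Poly_Mapping.lookup f \<sigma> * Poly_Mapping.lookup g \<nu>))"
    unfolding shuffle_mult_def using assms
    by (intro sum.cong refl sum.mono_neutral_left) (auto simp: in_keys_iff)
  also have "\<dots> = (\<Sum>\<sigma>\<in>A. \<Sum>\<nu>\<in>B. \<Sum>\<pi>\<in>shifted_shuffles \<sigma> \<nu>.
     Poly_Mapping.single \<pi> (Poly_Mapping.lookup f \<sigma> * Poly_Mapping.lookup g \<nu>))"
    using assms by (intro sum.mono_neutral_left) (auto simp: in_keys_iff)
  finally show ?thesis .
qed

lemma shuffle_mult_add_left: "shuffle_mult (f + f') g = shuffle_mult f g + shuffle_mult f' g"
proof -
  let ?A = "Poly_Mapping.keys f \<union> Poly_Mapping.keys f'"
  have k: "Poly_Mapping.keys (f + f') \<subseteq> ?A" by (rule keys_add)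
  show ?thesis
    by (simp add: shuffle_mult_superset[of ?A "Poly_Mapping.keys g" "f + f'"] k
        shuffle_mult_superset[of ?A "Poly_Mapping.keys g" f] shuffle_mult_superset[of ?A "Poly_Mapping.keys g" f']
        lookup_add distrib_right single_add sum.distrib)
qed

lemma shuffle_mult_add_right: "shuffle_mult f (g + g') = shuffle_mult f g + shuffle_mult f g'"
proof -
  let ?B = "Poly_Mapping.keys g \<union> Poly_Mapping.keys g'"
  have k: "Poly_Mapping.keys (g + g') \<subseteq> ?B" by (rule keys_add)
  show ?thesis
    by (simp add: shuffle_mult_superset[of "Poly_Mapping.keys f" ?B f "g + g'"] k
        shuffle_mult_superset[of "Poly_Mapping.keys f" ?B f g] shuffle_mult_superset[of "Poly_Mapping.keys f" ?B f g']
        lookup_add distrib_left single_add sum.distrib)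
qed

lemma shuffle_mult_sum_left: "shuffle_mult (sum f A) g = (\<Sum>x\<in>A. shuffle_mult (f x) g)"
  by (rule additive.sum) (simp add: additive_def shuffle_mult_add_left)

lemma shuffle_mult_sum_right: "shuffle_mult g (sum f A) = (\<Sum>x\<in>A. shuffle_mult g (f x))"
  by (rule additive.sum) (simp add: additive_def shuffle_mult_add_right)

lemma shuffle_mult_single:
  "shuffle_mult (Poly_Mapping.single \<sigma> a) (Poly_Mapping.single \<nu> b) =
     (\<Sum>\<pi>\<in>shifted_shuffles \<sigma> \<nu>. Poly_Mapping.single \<pi> (a * b))"
  by (subst shuffle_mult_superset[of "{\<sigma>}" "{\<nu>}"]) auto

lemma poly_mapping_expand: "f = (\<Sum>x\<in>Poly_Mapping.keys f. Poly_Mapping.single x (Poly_Mapping.lookup f x))"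
  by (rule poly_mapping_eqI) (simp add: lookup_sum lookup_single when_def in_keys_iff sum.delta')

lemma shuffle_mult_expand_left:
  "shuffle_mult f g =
     (\<Sum>\<sigma>\<in>Poly_Mapping.keys f. shuffle_mult (Poly_Mapping.single \<sigma> (Poly_Mapping.lookup f \<sigma>)) g)"
proof -
  have "shuffle_mult f g = shuffle_mult
      (\<Sum>\<sigma>\<in>Poly_Mapping.keys f. Poly_Mapping.single \<sigma> (Poly_Mapping.lookup f \<sigma>)) g"
    by (rule arg_cong[of _ _ "\<lambda>f. shuffle_mult f g"], rule poly_mapping_expand)
  then show ?thesis by (simp only: shuffle_mult_sum_left)
qed

lemma shuffle_mult_expand_right:
  "shuffle_mult f g =
     (\<Sum>\<nu>\<in>Poly_Mapping.keys g. shuffle_mult f (Poly_Mapping.single \<nu> (Poly_Mapping.lookup g \<nu>)))"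
proof -
  have "shuffle_mult f g = shuffle_mult f
      (\<Sum>\<nu>\<in>Poly_Mapping.keys g. Poly_Mapping.single \<nu> (Poly_Mapping.lookup g \<nu>))"
    by (rule arg_cong[of _ _ "shuffle_mult f"], rule poly_mapping_expand)
  then show ?thesis by (simp only: shuffle_mult_sum_right)
qed

lemma shuffle_mult_assoc:
  assumes "Poly_Mapping.keys f \<subseteq> perms" "Poly_Mapping.keys g \<subseteq> perms" "Poly_Mapping.keys h \<subseteq> perms"
  shows "shuffle_mult (shuffle_mult f g) h = shuffle_mult f (shuffle_mult g h)"
proof -
  let ?s = "\<lambda>f x. Poly_Mapping.single x (Poly_Mapping.lookup f x)"
  have 1: "shuffle_mult (shuffle_mult (?s f \<sigma>) (?s g \<nu>)) (?s h \<rho>) =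
           shuffle_mult (?s f \<sigma>) (shuffle_mult (?s g \<nu>) (?s h \<rho>))"
    if "\<sigma> \<in> perms" "\<nu> \<in> perms" "\<rho> \<in> perms" for \<sigma> \<nu> \<rho>
    by (simp add: shuffle_mult_single shuffle_mult_sum_left shuffle_mult_sum_right mult.assoc
        sum_shifted_shuffles_assoc[OF that])
  have 2: "shuffle_mult (shuffle_mult (?s f \<sigma>) (?s g \<nu>)) h =
           shuffle_mult (?s f \<sigma>) (shuffle_mult (?s g \<nu>) h)"
    if "\<sigma> \<in> perms" "\<nu> \<in> perms" for \<sigma> \<nu>
    unfolding shuffle_mult_expand_right[of _ h] shuffle_mult_sum_right
    by (rule sum.cong[OF refl 1]) (use that assms(3) in auto)
  have 3: "shuffle_mult (shuffle_mult (?s f \<sigma>) g) h = shuffle_mult (?s f \<sigma>) (shuffle_mult g h)"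
    if "\<sigma> \<in> perms" for \<sigma>
    unfolding shuffle_mult_expand_right[of _ g] shuffle_mult_expand_left[of g]
      shuffle_mult_sum_left shuffle_mult_sum_right
    by (rule sum.cong[OF refl 2]) (use that assms(2) in auto)
  show ?thesis
    unfolding shuffle_mult_expand_left[of f] shuffle_mult_sum_left
    by (rule sum.cong[OF refl 3]) (use assms(1) in auto)
qed

lemma shuffle_mult_one_left: "shuffle_mult (Poly_Mapping.single [] 1) f = f"
  by (subst shuffle_mult_expand_right)
     (simp add: shuffle_mult_single shifted_shuffles_def shift_def poly_mapping_expand[symmetric])

lemma shuffle_mult_one_right: "shuffle_mult f (Poly_Mapping.single [] 1) = f"
  by (subst shuffle_mult_expand_left)
     (simp add: shuffle_mult_single shifted_shuffles_def shift_def poly_mapping_expand[symmetric])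

lemma keys_shuffle_mult:
  assumes "Poly_Mapping.keys f \<subseteq> perms" "Poly_Mapping.keys g \<subseteq> perms"
  shows "Poly_Mapping.keys (shuffle_mult f g) \<subseteq> perms"
  unfolding shuffle_mult_def
proof (intro order_trans[OF keys_sum] UN_least)
  fix \<sigma> \<nu> \<pi>
  assume "\<sigma> \<in> Poly_Mapping.keys f" "\<nu> \<in> Poly_Mapping.keys g" "\<pi> \<in> shifted_shuffles \<sigma> \<nu>"
  then have "\<pi> \<in> perms" using assms shifted_shuffles_perms by blast
  then show "Poly_Mapping.keys (Poly_Mapping.single \<pi>
      (Poly_Mapping.lookup f \<sigma> * Poly_Mapping.lookup g \<nu>)) \<subseteq> perms"
    by simp
qed

lemma lookup_scale [simp]:
  "Poly_Mapping.lookup (Poly_Mapping.map ((*) c) f) x = c * Poly_Mapping.lookup f x"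
  for c :: "'k::comm_ring_1"
  by (simp add: map.rep_eq when_def)

lemma keys_scale: "Poly_Mapping.keys (Poly_Mapping.map ((*) c) f) \<subseteq> Poly_Mapping.keys f"
  for c :: "'k::comm_ring_1"
  by (auto simp: in_keys_iff)

lemma scale_sum:
  "Poly_Mapping.map ((*) c) (sum h A) = (\<Sum>x\<in>A. Poly_Mapping.map ((*) c) (h x))"
  for c :: "'k::comm_ring_1"
  by (rule poly_mapping_eqI) (simp add: lookup_sum sum_distrib_left)

lemma scale_single:
  "Poly_Mapping.map ((*) c) (Poly_Mapping.single x d) = Poly_Mapping.single x (c * d)"
  for c :: "'k::comm_ring_1"
  by (rule poly_mapping_eqI) (simp add: lookup_single when_def)

lemma shuffle_mult_scale_left:
  "Poly_Mapping.map ((*) c) (shuffle_mult f g) = shuffle_mult (Poly_Mapping.map ((*) c) f) g"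
proof -
  have "shuffle_mult (Poly_Mapping.map ((*) c) f) g =
    (\<Sum>\<sigma>\<in>Poly_Mapping.keys f. \<Sum>\<nu>\<in>Poly_Mapping.keys g. \<Sum>\<pi>\<in>shifted_shuffles \<sigma> \<nu>.
      Poly_Mapping.single \<pi> (c * Poly_Mapping.lookup f \<sigma> * Poly_Mapping.lookup g \<nu>))"
    by (subst shuffle_mult_superset[OF _ _ keys_scale order_refl]) simp_all
  then show ?thesis
    by (simp add: shuffle_mult_def scale_sum scale_single mult.assoc)
qed

lemma shuffle_mult_scale_right:
  "Poly_Mapping.map ((*) c) (shuffle_mult f g) = shuffle_mult f (Poly_Mapping.map ((*) c) g)"
proof -
  have "shuffle_mult f (Poly_Mapping.map ((*) c) g) =
    (\<Sum>\<sigma>\<in>Poly_Mapping.keys f. \<Sum>\<nu>\<in>Poly_Mapping.keys g. \<Sum>\<pi>\<in>shifted_shuffles \<sigma> \<nu>.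
      Poly_Mapping.single \<pi> (Poly_Mapping.lookup f \<sigma> * (c * Poly_Mapping.lookup g \<nu>)))"
    by (subst shuffle_mult_superset[OF _ _ order_refl keys_scale]) simp_all
  then show ?thesis
    by (simp add: shuffle_mult_def scale_sum scale_single mult.left_commute)
qed

text \<open>The elements of FQSym are the finite linear combinations of permutations.\<close>
typedef (overloaded) 'k fqsym = "{f :: nat list \<Rightarrow>\<^sub>0 'k::zero. Poly_Mapping.keys f \<subseteq> perms}"
  by (rule exI[of _ 0]) simp

setup_lifting type_definition_fqsym

instantiation fqsym :: (comm_ring_1) ring_1
begin

lift_definition zero_fqsym :: "'a fqsym" is 0 by simp

lift_definition one_fqsym :: "'a fqsym" is "Poly_Mapping.single [] 1" by simp

lift_definition plus_fqsym :: "'a fqsym \<Rightarrow> 'a fqsym \<Rightarrow> 'a fqsym" is "(+)"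
  by (rule order_trans[OF keys_add]) (rule Un_least)

lift_definition uminus_fqsym :: "'a fqsym \<Rightarrow> 'a fqsym" is uminus
  by (auto simp: in_keys_iff subset_iff)

lift_definition minus_fqsym :: "'a fqsym \<Rightarrow> 'a fqsym \<Rightarrow> 'a fqsym" is "(-)"
  by (rule order_trans[OF keys_diff]) (rule Un_least)

lift_definition times_fqsym :: "'a fqsym \<Rightarrow> 'a fqsym \<Rightarrow> 'a fqsym" is shuffle_mult
  by (rule keys_shuffle_mult)

instance
proof
  fix a b c :: "'a fqsym"
  show "a * b * c = a * (b * c)" by transfer (rule shuffle_mult_assoc)
  show "(a + b) * c = a * c + b * c" by transfer (rule shuffle_mult_add_left)
  show "a * (b + c) = a * b + a * c" by transfer (rule shuffle_mult_add_right)
  show "1 * a = a" by transfer (rule shuffle_mult_one_left)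
  show "a * 1 = a" by transfer (rule shuffle_mult_one_right)
  show "(0 :: 'a fqsym) \<noteq> 1" by transfer (metis lookup_single_eq lookup_zero zero_neq_one)
  show "a + b + c = a + (b + c)" by transfer (rule add.assoc)
  show "a + b = b + a" by transfer (rule add.commute)
  show "0 + a = a" by transfer (rule add_0)
  show "- a + a = 0" by transfer (rule left_minus)
  show "a - b = a + - b" by transfer (rule diff_conv_add_uminus)
qed

end

lift_definition fqsym_scale :: "'k::comm_ring_1 \<Rightarrow> 'k fqsym \<Rightarrow> 'k fqsym"
  is "\<lambda>c. Poly_Mapping.map ((*) c)"
  by (rule order_trans[OF keys_scale])

lift_definition fqsym_F :: "nat list \<Rightarrow> 'k::comm_ring_1 fqsym"
  is "\<lambda>\<sigma>. if \<sigma> \<in> perms then Poly_Mapping.single \<sigma> 1 else 0"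
  by simp

interpretation fqsym: vector_space "fqsym_scale :: 'k::field \<Rightarrow> 'k fqsym \<Rightarrow> 'k fqsym"
proof
  fix a b :: 'k and x y :: "'k fqsym"
  show "fqsym_scale a (x + y) = fqsym_scale a x + fqsym_scale a y"
    by transfer (rule poly_mapping_eqI, simp add: lookup_add distrib_left)
  show "fqsym_scale (a + b) x = fqsym_scale a x + fqsym_scale b x"
    by transfer (rule poly_mapping_eqI, simp add: lookup_add distrib_right)
  show "fqsym_scale a (fqsym_scale b x) = fqsym_scale (a * b) x"
    by transfer (rule poly_mapping_eqI, simp add: mult.assoc)
  show "fqsym_scale 1 x = x"
    by transfer (rule poly_mapping_eqI, simp)
qed

lemma fqsym_F_mult:
  assumes "\<sigma> \<in> perms" "\<nu> \<in> perms"
  shows "(fqsym_F \<sigma> * fqsym_F \<nu> :: 'k::comm_ring_1 fqsym) = (\<Sum>\<pi>\<in>shifted_shuffles \<sigma> \<nu>. fqsym_F \<pi>)"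
proof -
  have sum: "Rep_fqsym (sum h A) = (\<Sum>x\<in>A. Rep_fqsym (h x))" for h :: "_ \<Rightarrow> 'k fqsym" and A :: "nat list set"
    by (induction A rule: infinite_finite_induct) (simp_all add: zero_fqsym.rep_eq plus_fqsym.rep_eq)
  show ?thesis
    using assms
    by (auto simp: Rep_fqsym_inject[symmetric] sum times_fqsym.rep_eq fqsym_F.rep_eq shuffle_mult_single
        intro!: sum.cong dest: shifted_shuffles_perms)
qed

lemma one_eq_fqsym_F: "(1 :: 'k::comm_ring_1 fqsym) = fqsym_F []"
  by transfer simp

lemma fqsym_scale_mult_left: "fqsym_scale c (a * b) = fqsym_scale c a * b"
  by transfer (rule shuffle_mult_scale_left)

lemma fqsym_scale_mult_right: "fqsym_scale c (a * b) = a * fqsym_scale c b"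
  by transfer (rule shuffle_mult_scale_right)


section \<open>Pairs of twin binary trees\<close>

text \<open>A binary tree is a \<^typ>\<open>unit tree\<close>; its number of nodes is its \<^const>\<open>size\<close>.\<close>

type_synonym tree_pair = "unit tree \<times> unit tree"

text \<open>
  The leaves from left to right, a leaf being coded by \<open>0\<close> if it is a right child and by \<open>1\<close> if
  it is a left child. The first argument is the code of the root in case the tree is a
  single leaf; it has no influence on the canopy.
\<close>
fun leaf_word :: "nat \<Rightarrow> 'a tree \<Rightarrow> nat list" where
  "leaf_word d Leaf = [d]"
| "leaf_word d (Node l _ r) = leaf_word 1 l @ leaf_word 0 r"

definition canopy :: "'a tree \<Rightarrow> nat list" where
  "canopy t = butlast (tl (leaf_word 0 t))"

definition twin :: "tree_pair \<Rightarrow> bool" where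
  "twin J \<longleftrightarrow> size (fst J) = size (snd J) \<and>
     (\<forall>i < size (fst J) - 1. canopy (fst J) ! i \<noteq> canopy (snd J) ! i)"

fun bst_insert :: "'a::linorder \<Rightarrow> 'a tree \<Rightarrow> 'a tree" where
  "bst_insert x Leaf = Node Leaf x Leaf"
| "bst_insert x (Node l a r) =
     (if x \<le> a then Node (bst_insert x l) a r else Node l a (bst_insert x r))"

text \<open>The word is inserted from left to right. Its letters are distinct in all uses.\<close>
definition bst_of :: "'a::linorder list \<Rightarrow> 'a tree" where
  "bst_of w = fold bst_insert w Leaf"

definition shape :: "'a tree \<Rightarrow> unit tree" where
  "shape t = map_tree (\<lambda>_. ()) t"

definition P_symbol :: "nat list \<Rightarrow> tree_pair" where
  "P_symbol \<sigma> = (shape (bst_of \<sigma>), shape (bst_of (rev \<sigma>)))"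

definition baxter_le :: "tree_pair \<Rightarrow> tree_pair \<Rightarrow> bool" where
  "baxter_le J\<^sub>0 J\<^sub>1 \<longleftrightarrow> twin J\<^sub>0 \<and> twin J\<^sub>1 \<and>
     (\<exists>\<sigma>\<in>perms. \<exists>\<nu>\<in>perms. permutohedron_le \<sigma> \<nu> \<and> P_symbol \<sigma> = J\<^sub>0 \<and> P_symbol \<nu> = J\<^sub>1)"

definition connected_pair :: "tree_pair \<Rightarrow> bool" where
  "connected_pair J \<longleftrightarrow> (\<forall>\<sigma>\<in>perms. P_symbol \<sigma> = J \<longrightarrow> connected_perm \<sigma>)"

definition anticonnected_pair :: "tree_pair \<Rightarrow> bool" where
  "anticonnected_pair J \<longleftrightarrow> (\<forall>\<sigma>\<in>perms. P_symbol \<sigma> = J \<longrightarrow> anticonnected_perm \<sigma>)"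


section \<open>The algebra Baxter\<close>

text \<open>The lemmas below show that the sums in the next three definitions are finite.\<close>

definition baxter_P :: "tree_pair \<Rightarrow> 'k::comm_ring_1 fqsym" where
  "baxter_P J = (\<Sum>\<sigma> | \<sigma> \<in> perms \<and> P_symbol \<sigma> = J. fqsym_F \<sigma>)"

definition baxter_E :: "tree_pair \<Rightarrow> 'k::comm_ring_1 fqsym" where
  "baxter_E J = (\<Sum>J' | baxter_le J J'. baxter_P J')"

definition baxter_H :: "tree_pair \<Rightarrow> 'k::comm_ring_1 fqsym" where
  "baxter_H J = (\<Sum>J' | baxter_le J' J. baxter_P J')"

definition Baxter :: "'k::field fqsym set" where
  "Baxter = fqsym.span (baxter_P ` {J. twin J})"

lemma size_shape [simp]: "size (shape t) = size t"
  unfolding shape_def by (induction t) auto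

lemma size_bst_of [simp]: "size (bst_of w) = length w"
proof -
  have ins: "size (bst_insert x t) = Suc (size t)" for x :: 'a and t
    by (induction t) auto
  have "size (fold bst_insert w t) = length w + size t" for t
    by (induction w arbitrary: t) (auto simp: ins)
  then show ?thesis by (simp add: bst_of_def)
qed

lemma size_P_symbol: "size (fst (P_symbol \<sigma>)) = length \<sigma>" "size (snd (P_symbol \<sigma>)) = length \<sigma>"
  by (simp_all add: P_symbol_def)

lemma finite_perms_of_length: "finite {\<sigma> \<in> perms. length \<sigma> = n}"
  by (rule finite_subset[OF _ finite_lists_length_eq[of "{1..n}" n]]) (auto simp: perms_def)

lemma finite_P_symbol_fiber: "finite {\<sigma>. \<sigma> \<in> perms \<and> P_symbol \<sigma> = J}"
  by (rule finite_subset[OF _ finite_perms_of_length[of "size (fst J)"]])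
     (auto simp: size_P_symbol)

lemma permutohedron_le_length: "permutohedron_le \<sigma> \<nu> \<Longrightarrow> length \<sigma> = length \<nu>"
  unfolding permutohedron_le_def
  by (induction rule: rtranclp_induct) (auto elim!: permutohedron_cover.cases)

lemma finite_baxter_le: "finite {J'. baxter_le J J'}" "finite {J'. baxter_le J' J}"
  by (rule finite_subset[OF _ finite_imageI[OF finite_perms_of_length[of "size (fst J)"], of P_symbol]];
      force simp: baxter_le_def size_P_symbol dest: permutohedron_le_length)+


section \<open>Free algebras\<close>

text \<open>
  The free unital associative algebra on a set \<open>I\<close> consists of the noncommutative polynomials
  in the indeterminates \<open>i \<in> I\<close>, that is of the finite linear combinations of words over \<open>I\<close>.
  A family \<open>x\<close> of elements of an algebra with scalar multiplication \<open>scale\<close> induces the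
  evaluation morphism \<open>free_eval scale x\<close> from it, which sends the indeterminate \<open>i\<close> to
  \<open>x i\<close> and a word to the product of its letters. The subalgebra \<open>A\<close> is free on the family
  if this morphism is an isomorphism onto \<open>A\<close>.
\<close>
definition free_eval :: "('k::field \<Rightarrow> 'a::ring_1 \<Rightarrow> 'a) \<Rightarrow> ('i \<Rightarrow> 'a) \<Rightarrow> ('i list \<Rightarrow>\<^sub>0 'k) \<Rightarrow> 'a" where
  "free_eval scale x p =
     (\<Sum>w\<in>Poly_Mapping.keys p. scale (Poly_Mapping.lookup p w) (prod_list (map x w)))"

definition free_on :: "('k::field \<Rightarrow> 'a::ring_1 \<Rightarrow> 'a) \<Rightarrow> 'a set \<Rightarrow> ('i \<Rightarrow> 'a) \<Rightarrow> 'i set \<Rightarrow> bool" where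
  "free_on scale A x I \<longleftrightarrow>
     bij_betw (free_eval scale x) {p. Poly_Mapping.keys p \<subseteq> lists I} A"

end

theory Submission
  imports Defs
begin

text \<open>
  A permutation \<open>\<sigma>\<close> is determined by its inversions. Those inversions \<open>(a, b)\<close> for which \<open>b\<close> is the
  first, or \<open>a\<close> the last, of the letters in the interval \<open>[a, b]\<close> form a set \<open>forced \<sigma>\<close> that depends
  only on \<open>J = P_symbol \<sigma>\<close> and increases with \<open>\<sigma>\<close>; its transitive closure is the inversion set of the
  least permutation with the same pair of trees. Hence \<open>E\<^sub>J\<close> is the sum of the \<open>F\<^sub>\<nu>\<close> over all \<open>\<nu>\<close>
  whose inversions contain \<open>forced \<sigma>\<close>. Since \<open>forced\<close> is additive under the concatenation
  \<open>\<sigma> / \<nu>\<close>, the family \<open>E\<close> is multiplicative; it is a basis by triangularity, and it is free because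
  the factors of a concatenation are cut out by the positions that no forced inversion crosses.
  Reversing words is an automorphism of the algebra that exchanges the families \<open>E\<close> and \<open>H\<close>.
\<close>

section \<open>Words with distinct letters\<close>

text \<open>The theorem is indexed by all twin pairs, defined through canopies, whereas the algebra
  deals with permutations. A twin pair that came from no permutation would have
  \<open>baxter_E\<close> equal to zero and would ruin freeness, so \<open>P_symbol\<close> must be
  shown to be surjective onto twin pairs. Trees and words meet in one relation on letters:
  \<open>a\<close> is an ancestor of \<open>b\<close> in the search tree iff \<open>a\<close> comes
  first among the letters with values from one to the other. It turns equality of trees, canopies
  and the Baxter order into statements about the order of letters. The Baxter order only asks for
  some pair of representatives, so neither its transitivity nor its antisymmetry is evident. The
  least permutation of a class serves as a canonical representative with which every other
  permutation can be compared. The family \<open>E\<close> is multiplicative because a shifted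
  shuffle leaves free exactly the inversions between a letter of the first factor and a letter of
  the second, and a concatenation forces none of these.\<close>

fun before :: "'a list \<Rightarrow> ('a \<times> 'a) set" where
  "before [] = {}"
| "before (x # w) = {x} \<times> set w \<union> before w"

lemma before_subset: "before w \<subseteq> set w \<times> set w"
  by (induction w) auto

lemma before_in_set: "(a, b) \<in> before w \<Longrightarrow> a \<in> set w \<and> b \<in> set w"
  using before_subset by fast

lemma before_append: "before (u @ v) = before u \<union> before v \<union> set u \<times> set v"
  by (induction u) auto

lemma before_rev: "before (rev w) = (before w)\<inverse>"
  by (induction w) (auto simp: before_append)

lemma before_rev_iff [simp]: "(a, b) \<in> before (rev w) \<longleftrightarrow> (b, a) \<in> before w"
  by (simp add: before_rev)

lemma before_filter: "before (filter P w) = {(a, b) \<in> before w. P a \<and> P b}"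
  by (induction w) auto

lemma before_map: "before (map f w) = map_prod f f ` before w"
  by (induction w) auto

lemma before_total: "\<lbrakk>a \<in> set w; b \<in> set w; a \<noteq> b\<rbrakk> \<Longrightarrow> (a, b) \<in> before w \<or> (b, a) \<in> before w"
  by (induction w) auto

lemma before_asym: "\<lbrakk>distinct w; (a, b) \<in> before w\<rbrakk> \<Longrightarrow> (b, a) \<notin> before w"
  by (induction w) (auto dest: before_in_set)

lemma before_irrefl: "distinct w \<Longrightarrow> (a, a) \<notin> before w"
  using before_asym by fast

lemma before_trans: "\<lbrakk>distinct w; (a, b) \<in> before w; (b, c) \<in> before w\<rbrakk> \<Longrightarrow> (a, c) \<in> before w"
  by (induction w) (auto dest: before_in_set)

lemma before_not_iff:
  "\<lbrakk>distinct w; a \<in> set w; b \<in> set w; a \<noteq> b\<rbrakk> \<Longrightarrow> (a, b) \<notin> before w \<longleftrightarrow> (b, a) \<in> before w"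
  using before_total before_asym by metis

lemma before_inj:
  assumes "distinct w" "distinct w'" "set w = set w'" "before w = before w'"
  shows "w = w'"
  using assms
proof (induction w arbitrary: w')
  case (Cons x w)
  from Cons.prems(3) obtain y v where w': "w' = y # v" by (cases w') simp_all
  have "x = y"
  proof (rule ccontr)
    assume "x \<noteq> y"
    moreover have "y \<in> set (x # w)" "x \<in> set (y # v)"
      using Cons.prems(3) w' by (metis list.set_intros(1))+
    ultimately have "(x, y) \<in> before (x # w)" "(y, x) \<in> before w'"
      using w' by simp_all
    then show False using before_asym[OF Cons.prems(1)] Cons.prems(4) by blast
  qed
  moreover have x: "x \<notin> set w" "x \<notin> set v" using Cons.prems(1,2) w' \<open>x = y\<close> by simp_all
  moreover have "set w = set v"
    using Cons.prems(3) w' \<open>x = y\<close> x by (simp add: insert_ident)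
  moreover have "before w = before v"
  proof -
    have "before u = before (x # u) - {x} \<times> UNIV" if "x \<notin> set u" for u
      using that by (auto dest: before_in_set)
    then show ?thesis using Cons.prems(4) w' \<open>x = y\<close> x by metis
  qed
  ultimately show ?case using Cons.IH[of v] Cons.prems(1,2) w'
    by (metis distinct.simps(2))
qed simp

section \<open>Inversions and forced inversions\<close>

definition inversions :: "'a::linorder list \<Rightarrow> ('a \<times> 'a) set" where
  "inversions w = {(a, b). a < b \<and> (b, a) \<in> before w}"

text \<open>Reading \<open>w\<close> as a sequence of insertions, this is the ancestor relation of the binary search
  tree of \<open>w\<close>.\<close>
definition first :: "'a::linorder list \<Rightarrow> ('a \<times> 'a) set" where
  "first w = {(a, b). a \<in> set w \<and> b \<in> set w \<and>
     (\<forall>c\<in>set w. min a b \<le> c \<and> c \<le> max a b \<longrightarrow> c = a \<or> (a, c) \<in> before w)}"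

text \<open>The inversions that can be read off the two binary search trees of \<open>w\<close>: the letter \<open>b\<close> is an
  ancestor of \<open>a\<close> in the left to right tree, or a descendant of \<open>a\<close> in the right to left tree.\<close>
definition forced :: "'a::linorder list \<Rightarrow> ('a \<times> 'a) set" where
  "forced w = {(a, b). a < b \<and> ((b, a) \<in> first w \<or> (a, b) \<in> first (rev w))}"

lemma trans_inversions: "distinct w \<Longrightarrow> trans (inversions w)"
  unfolding trans_def inversions_def using before_trans by fastforce

lemma inversions_subset: "inversions w \<subseteq> set w \<times> set w"
  by (auto simp: inversions_def dest: before_in_set)

lemma before_eq_inversions:
  assumes "distinct w"
  shows "before w = {(a, b) \<in> set w \<times> set w. (b, a) \<in> inversions w \<or> a < b \<and> (a, b) \<notin> inversions w}"
  using before_not_iff[OF assms] before_irrefl[OF assms] before_asym[OF assms]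
  by (auto simp: inversions_def not_less_iff_gr_or_eq dest: before_in_set)

lemma inversions_inj:
  assumes "distinct w" "distinct w'" "set w = set w'" "inversions w = inversions w'"
  shows "w = w'"
  using assms by (intro before_inj) (simp_all add: before_eq_inversions)

lemma forced_subset_inversions: "forced w \<subseteq> inversions w"
  by (auto simp: forced_def inversions_def first_def min_def max_def split: if_splits)

text \<open>That \<open>b\<close> comes first in the interval \<open>[a, b]\<close> means that it is
  inverted with every smaller letter there, and dually for \<open>a\<close> coming last. Both
  conditions only demand inversions, hence \<open>forced_mono\<close>.\<close>

lemma forced_iff:
  assumes "distinct w"
  shows "(a, b) \<in> forced w \<longleftrightarrow> a \<in> set w \<and> b \<in> set w \<and> a < b \<and>
    ((\<forall>c\<in>set w. a \<le> c \<and> c < b \<longrightarrow> (c, b) \<in> inversions w) \<or> (\<forall>c\<in>set w. a < c \<and> c \<le> b \<longrightarrow> (a, c) \<in> inversions w))"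
proof (cases "a < b")
  case True
  have "(b, a) \<in> first w \<longleftrightarrow>
      a \<in> set w \<and> b \<in> set w \<and> (\<forall>c\<in>set w. a \<le> c \<and> c < b \<longrightarrow> (c, b) \<in> inversions w)"
    using True unfolding first_def inversions_def
    by (auto simp: min_def max_def)
  moreover have "(a, b) \<in> first (rev w) \<longleftrightarrow>
      a \<in> set w \<and> b \<in> set w \<and> (\<forall>c\<in>set w. a < c \<and> c \<le> b \<longrightarrow> (a, c) \<in> inversions w)"
    using True unfolding first_def inversions_def
    by (auto simp: min_def max_def)
  ultimately show ?thesis using True by (auto simp: forced_def)
qed (simp add: forced_def)

lemma forced_mono:
  assumes "distinct w" "distinct w'" "set w = set w'" "inversions w \<subseteq> inversions w'"
  shows "forced w \<subseteq> forced w'"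
proof (rule subrelI)
  fix a b assume "(a, b) \<in> forced w"
  then show "(a, b) \<in> forced w'"
    using assms(4) unfolding forced_iff[OF assms(1)] forced_iff[OF assms(2)] assms(3) by blast
qed

lemma before_swap:
  assumes "distinct (u @ [a, b] @ v)"
  shows "before (u @ [b, a] @ v) = before (u @ [a, b] @ v) - {(a, b)} \<union> {(b, a)}"
  using assms by (auto simp: before_append dest: before_in_set)

text \<open>In the search tree \<open>c\<close> separates \<open>a\<close> from \<open>d\<close>, so
  the relative order of these two is invisible. This is the relation generating the sylvester
  congruence, in its version for insertion from left to right.\<close>

lemma first_swap:
  assumes "distinct (u @ [a, d] @ v)" "c \<in> set u" "min a d < c" "c < max a d"
  shows "first (u @ [a, d] @ v) = first (u @ [d, a] @ v)"
proof -
  let ?w = "u @ [a, d] @ v" and ?w' = "u @ [d, a] @ v"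
  have "(c, a) \<in> before ?w" "(c, d) \<in> before ?w"
    using assms(2) by (simp_all add: before_append)
  then have c: "(a, c) \<notin> before ?w" "(d, c) \<notin> before ?w" "c \<in> set ?w" "c \<noteq> a" "c \<noteq> d"
    using assms(2) before_asym[OF assms(1)] before_irrefl[OF assms(1)] by auto
  have eq: "before ?w' = before ?w - {(a, d)} \<union> {(d, a)}"
    by (rule before_swap[OF assms(1)])
  have s: "set ?w' = set ?w" by auto
  have "(\<forall>x\<in>set ?w. min p q \<le> x \<and> x \<le> max p q \<longrightarrow> x = p \<or> (p, x) \<in> before ?w) \<longleftrightarrow>
        (\<forall>x\<in>set ?w. min p q \<le> x \<and> x \<le> max p q \<longrightarrow> x = p \<or> (p, x) \<in> before ?w')" (is "?L \<longleftrightarrow> ?R")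
    for p q
  \<comment> \<open>The words differ only in the order of \<open>a\<close> and \<open>d\<close>. If
    \<open>p\<close> is one of them and the interval contains the other, it also contains
    \<open>c\<close>, and both sides fail at \<open>c\<close>.\<close>
  proof (cases "(p = a \<and> min p q \<le> d \<and> d \<le> max p q) \<or> (p = d \<and> min p q \<le> a \<and> a \<le> max p q)")
    case True
    then have "min p q \<le> c \<and> c \<le> max p q"
      using assms(3,4) by (auto simp: min_def max_def split: if_splits)
    moreover have "c \<noteq> p" "(p, c) \<notin> before ?w" "(p, c) \<notin> before ?w'"
      using True c unfolding eq by auto
    ultimately show ?thesis using c(3) by blast
  next
    case False
    then have "(p, x) \<in> before ?w \<longleftrightarrow> (p, x) \<in> before ?w'" if "min p q \<le> x" "x \<le> max p q" for x
      using that unfolding eq by auto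
    then show ?thesis by meson
  qed
  then show ?thesis unfolding first_def s by auto
qed

section \<open>Binary search trees\<close>

lemma fold_bst_insert_Node:
  "fold bst_insert w (Node l x r) =
     Node (fold bst_insert (filter (\<lambda>y. y \<le> x) w) l) x (fold bst_insert (filter (\<lambda>y. x < y) w) r)"
  by (induction w arbitrary: l r) (auto simp: not_le)

lemma bst_of_Cons:
  "x \<notin> set w \<Longrightarrow> bst_of (x # w) =
     Node (bst_of (filter (\<lambda>y. y < x) w)) x (bst_of (filter (\<lambda>y. x < y) w))"
  unfolding bst_of_def by (simp add: fold_bst_insert_Node) (metis (mono_tags, lifting) filter_cong order_less_le)

text \<open>The recursion of \<open>bst_of_Cons\<close> runs over two filtered words, in general not
  suffixes, so the induction is on the length.\<close>

lemma bst_of_induct [consumes 1, case_names Nil Cons]: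
  assumes "distinct w" "P []"
    and "\<And>x w. \<lbrakk>x \<notin> set w; distinct w; P (filter (\<lambda>y. y < x) w); P (filter (\<lambda>y. x < y) w)\<rbrakk>
           \<Longrightarrow> P (x # w :: 'a::linorder list)"
  shows "P w"
  using assms(1)
proof (induction w rule: length_induct)
  case (1 w)
  show ?case
  proof (cases w)
    case (Cons x v)
    have "P (filter Q v)" for Q
    proof -
      have "length (filter Q v) < length w" "distinct (filter Q v)"
        using Cons 1(2) by (simp_all add: less_Suc_eq_le)
      then show ?thesis using 1(1) by blast
    qed
    then show ?thesis using assms(3)[of x v] Cons 1(2) by simp
  qed (simp add: assms(2))
qed

lemma split_letters: "x \<notin> set w \<Longrightarrow> {y \<in> set w. y < x} \<union> {y \<in> set w. x < y} = set w"
  for x :: "'a::linorder"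
  using less_linear by blast

lemma set_tree_bst_of: "distinct w \<Longrightarrow> set_tree (bst_of w) = set w"
proof (induction w rule: bst_of_induct)
  case Nil then show ?case by (simp add: bst_of_def)
next
  case (Cons x w)
  note split_letters[OF Cons(1)]
  then show ?case by (simp add: bst_of_Cons[OF Cons(1)] Cons(3,4))
qed

lemma bst_bst_of: "distinct w \<Longrightarrow> bst (bst_of w)"
proof (induction w rule: bst_of_induct)
  case Nil then show ?case by (simp add: bst_of_def)
next
  case (Cons x w)
  then show ?case by (auto simp: bst_of_Cons set_tree_bst_of)
qed

text \<open>Reflexive on the labels, so that the relation alone also determines the label
  set.\<close>

fun ancestors :: "'a tree \<Rightarrow> ('a \<times> 'a) set" where
  "ancestors Leaf = {}"
| "ancestors (Node l x r) = {x} \<times> insert x (set_tree l \<union> set_tree r) \<union> ancestors l \<union> ancestors r"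

lemma ancestors_subset: "ancestors t \<subseteq> set_tree t \<times> set_tree t"
  by (induction t) auto

text \<open>The head \<open>x\<close> precedes everything, so no other letter can be first in an
  interval containing \<open>x\<close>. The remaining pairs lie entirely below or entirely above
  \<open>x\<close>.\<close>

lemma first_Cons:
  assumes "x \<notin> set w"
  shows "first (x # w) = {x} \<times> insert x (set w) \<union> first (filter (\<lambda>y. y < x) w) \<union> first (filter (\<lambda>y. x < y) w)"
proof -
  have "(a, b) \<in> first (x # w) \<longleftrightarrow> (a, b) \<in> {x} \<times> insert x (set w) \<union>
      first (filter (\<lambda>y. y < x) w) \<union> first (filter (\<lambda>y. x < y) w)" for a b
  proof (cases "a = x")
    case True
    then show ?thesis by (auto simp: first_def)
  next
    case False
    show ?thesis
    proof (cases "min a b \<le> x \<and> x \<le> max a b")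
      case True
      then show ?thesis using False assms
        by (auto simp: first_def min_def max_def before_filter split: if_splits dest: before_in_set)
    next
      case between: False
      then consider "a < x" "b < x" | "x < a" "x < b"
        by (auto simp: min_def max_def not_le split: if_splits)
      then show ?thesis
        using False by cases (auto simp: first_def before_filter min_def max_def)
    qed
  qed
  then show ?thesis by auto
qed

text \<open>\<open>first_Cons\<close> is the recursion of \<open>ancestors\<close> along
  \<open>bst_of_Cons\<close>.\<close>

lemma ancestors_bst_of: "distinct w \<Longrightarrow> ancestors (bst_of w) = first w"
proof (induction w rule: bst_of_induct)
  case Nil then show ?case by (simp add: bst_of_def first_def)
next
  case (Cons x w)
  note split_letters[OF Cons(1)]
  then show ?case using Cons by (simp add: bst_of_Cons first_Cons set_tree_bst_of)
qed

lemma ancestors_antisym: "\<lbrakk>bst t; (a, b) \<in> ancestors t; (b, a) \<in> ancestors t\<rbrakk> \<Longrightarrow> a = b"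
proof (induction t)
  case (Node l x r)
  then have "y < x" if "y \<in> set_tree l" for y using that by simp
  moreover have "x < y" if "y \<in> set_tree r" for y using Node.prems(1) that by simp
  moreover have "y \<in> set_tree l \<and> z \<in> set_tree l" if "(y, z) \<in> ancestors l" for y z
    using that ancestors_subset by fast
  moreover have "y \<in> set_tree r \<and> z \<in> set_tree r" if "(y, z) \<in> ancestors r" for y z
    using that ancestors_subset by fast
  ultimately show ?case using Node by (auto dest: less_asym) (meson less_asym less_irrefl)+
qed simp

lemma ancestors_Node:
  assumes "bst (Node l x r)"
  shows "ancestors l = {(a, b) \<in> ancestors (Node l x r). a < x \<and> b < x}"
    and "ancestors r = {(a, b) \<in> ancestors (Node l x r). x < a \<and> x < b}"
  using assms ancestors_subset[of l] ancestors_subset[of r] by fastforce+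

lemma ancestors_refl: "a \<in> set_tree t \<Longrightarrow> (a, a) \<in> ancestors t"
  by (induction t) auto

lemma set_tree_eq_ancestors: "set_tree t = {a. (a, a) \<in> ancestors t}"
  using ancestors_refl ancestors_subset by fast

text \<open>The root is an ancestor of every node, and by antisymmetry only one node is. The
  relations of the subtrees are the restrictions to the labels below and above it.\<close>

lemma ancestors_inj:
  assumes "bst t" "bst t'" "ancestors t = ancestors t'"
  shows "t = t'"
  using assms
proof (induction t arbitrary: t')
  case Leaf
  then show ?case by (cases t') auto
next
  case (Node l x r)
  then obtain l' y r' where t': "t' = Node l' y r'" by (cases t') simp_all
  have st: "set_tree (Node l x r) = set_tree t'"
    by (simp only: set_tree_eq_ancestors Node.prems(3))
  have "(x, y) \<in> ancestors (Node l x r)"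
  proof -
    have "y \<in> set_tree (Node l x r)" unfolding st t' by simp
    then show ?thesis by auto
  qed
  moreover have "(y, x) \<in> ancestors t'"
  proof -
    have "x \<in> set_tree t'" unfolding st[symmetric] by simp
    then show ?thesis using t' by auto
  qed
  ultimately have "x = y"
    using ancestors_antisym[OF Node.prems(1), of x y] unfolding Node.prems(3) by blast
  moreover have "ancestors l = ancestors l'" "ancestors r = ancestors r'"
    using Node.prems(2,3)
    unfolding ancestors_Node[OF Node.prems(1)] t' \<open>x = y\<close>
    by (simp_all only: ancestors_Node)
  ultimately show ?case using Node.IH[of l'] Node.IH(2)[of r'] Node.prems(1,2) t' by simp
qed

lemma bst_of_eq_iff:
  "\<lbrakk>distinct w; distinct w'\<rbrakk> \<Longrightarrow> bst_of w = bst_of w' \<longleftrightarrow> first w = first w'"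
  using ancestors_inj[OF bst_bst_of bst_bst_of] ancestors_bst_of by metis

text \<open>The shape gives the size of each left subtree, hence the place where to cut the inorder
  list. For a permutation that list is always \<open>[1..<Suc n]\<close>, so passing from search
  trees to shapes loses nothing.\<close>

lemma shape_inorder_inj:
  "\<lbrakk>shape t = shape t'; inorder t = inorder t'\<rbrakk> \<Longrightarrow> t = t'"
proof (induction t arbitrary: t')
  case Leaf
  then show ?case by (cases t') (auto simp: shape_def)
next
  case (Node l x r)
  then obtain l' y r' where t': "t' = Node l' y r'" by (cases t') (auto simp: shape_def)
  have sh: "shape l = shape l'" "shape r = shape r'" using Node.prems t' by (auto simp: shape_def)
  then have "length (inorder l) = length (inorder l')" by (metis length_inorder size_shape)
  then show ?case using Node t' sh by auto
qed

lemma inorder_bst_of_perm: "\<sigma> \<in> perms \<Longrightarrow> inorder (bst_of \<sigma>) = [1..<Suc (length \<sigma>)]"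
  using bst_bst_of[of \<sigma>] set_tree_bst_of[of \<sigma>]
  by (intro sorted_distinct_set_unique)
     (auto simp: bst_iff_sorted_wrt_less strict_sorted_iff perms_def simp del: upt_Suc)

lemma shape_bst_of_eq_iff:
  assumes "\<sigma> \<in> perms" "\<nu> \<in> perms"
  shows "shape (bst_of \<sigma>) = shape (bst_of \<nu>) \<longleftrightarrow> first \<sigma> = first \<nu>"
proof -
  have "bst_of \<sigma> = bst_of \<nu>" if "shape (bst_of \<sigma>) = shape (bst_of \<nu>)"
  proof -
    have "length \<sigma> = length \<nu>" using that by (metis size_bst_of size_shape)
    then show ?thesis
      by (intro shape_inorder_inj[OF that])
        (simp only: inorder_bst_of_perm[OF assms(1)] inorder_bst_of_perm[OF assms(2)])
  qed
  moreover have "bst_of \<sigma> = bst_of \<nu> \<longleftrightarrow> first \<sigma> = first \<nu>"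
    using assms by (intro bst_of_eq_iff) (simp_all add: perms_def)
  ultimately show ?thesis by metis
qed

lemma rev_perms [simp]: "rev \<sigma> \<in> perms \<longleftrightarrow> \<sigma> \<in> perms"
  by (simp add: perms_def)

lemma P_symbol_eq_iff:
  "\<lbrakk>\<sigma> \<in> perms; \<nu> \<in> perms\<rbrakk> \<Longrightarrow>
     P_symbol \<sigma> = P_symbol \<nu> \<longleftrightarrow> first \<sigma> = first \<nu> \<and> first (rev \<sigma>) = first (rev \<nu>)"
  by (simp add: P_symbol_def shape_bst_of_eq_iff)

lemma before_split: "(a, b) \<in> before w \<Longrightarrow> \<exists>u m v. w = u @ a # m @ b # v"
proof (induction w)
  case (Cons x w)
  show ?case
  proof (cases "a = x \<and> b \<in> set w")
    case True
    then show ?thesis by (metis append_Nil split_list)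
  next
    case False
    then have "(a, b) \<in> before w" using Cons.prems by auto
    then show ?thesis using Cons.IH by (metis append_Cons)
  qed
qed simp

lemma adjacent_change:
  "\<lbrakk>P (hd w); \<not> P (last w); w \<noteq> []\<rbrakk> \<Longrightarrow> \<exists>p y z q. w = p @ [y, z] @ q \<and> P y \<and> \<not> P z"
proof (induction w)
  case (Cons x w)
  show ?case
  proof (cases "w = []")
    case False
    show ?thesis
    proof (cases "P (hd w)")
      case True
      then obtain p y z q where "w = p @ [y, z] @ q \<and> P y \<and> \<not> P z"
        using Cons False by auto
      then show ?thesis by (metis append_Cons)
    next
      case hd: False
      have "x # w = [] @ [x, hd w] @ tl w" using False by simp
      then show ?thesis using Cons.prems(1) hd by (metis list.sel(1))
    qed
  qed (use Cons in simp)
qed simp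

text \<open>Of the letters between an inverted pair \<open>d\<close>, \<open>a\<close>, either one has a value between \<open>a\<close> and \<open>d\<close>, or
  some descent straddles both \<open>a\<close> and \<open>d\<close>; in the second case \<open>(a, d)\<close> is itself forced.\<close>
lemma inversions_subset_trancl_forced:
  assumes w: "distinct w"
    and desc: "\<And>u a d v. \<lbrakk>w = u @ [d, a] @ v; a < d\<rbrakk> \<Longrightarrow> (a, d) \<in> forced w"
  shows "inversions w \<subseteq> (forced w)\<^sup>+"
proof -
  have seg: "(a, d) \<in> (forced w)\<^sup>+" if "w = u @ d # m @ a # v" "a < d" for u d m a v
    using that
  proof (induction m arbitrary: u d a v rule: length_induct)
    case (1 m)
    note wm = 1(2) and ad = 1(3)
    show ?case
    proof (cases "\<exists>x\<in>set m. a < x \<and> x < d")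
      case True
      then obtain x m1 m2 where x: "a < x" "x < d" "m = m1 @ x # m2" by (metis split_list)
      have "length m1 < length m" "w = u @ d # m1 @ x # (m2 @ a # v)" using x wm by simp_all
      then have xd: "(x, d) \<in> (forced w)\<^sup>+" using 1(1) x(2) by blast
      have "length m2 < length m" "w = (u @ d # m1) @ x # m2 @ a # v" using x wm by simp_all
      then have "(a, x) \<in> (forced w)\<^sup>+" using 1(1) x(1) by blast
      then show ?thesis using xd by (rule trancl_trans)
    next
      case False
      have outside: "x \<le> a \<or> d \<le> x" if "x \<in> set (d # m @ [a])" for x
        using that False by (auto simp: not_less)
      \<comment> \<open>The segment starts with \<open>d\<close> and ends with \<open>a\<close>, so
        it somewhere drops from a letter at least \<open>d\<close> to one below \<open>d\<close>. As
        no value of the segment is strictly between \<open>a\<close> and \<open>d\<close>, that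
        descent straddles both.\<close>
      obtain p y z q where yz: "d # m @ [a] = p @ [y, z] @ q" "d \<le> y" "\<not> d \<le> z"
        using adjacent_change[of "\<lambda>x. d \<le> x" "d # m @ [a]"] ad by (auto simp: not_le)
      have "y \<in> set (d # m @ [a])" "z \<in> set (d # m @ [a])" unfolding yz(1) by simp_all
      then have z: "z \<le> a" and ym: "y \<in> set (d # m)" and zm: "z \<in> set (m @ [a])"
        using outside[of z] yz(2,3) ad by auto
      have "w = (u @ p) @ [y, z] @ (q @ v)" using yz(1) wm by (metis append.assoc append_Cons append_Nil)
      moreover have "z < y" using z ad yz(2) by order
      ultimately have "(z, y) \<in> forced w" by (rule desc)
      then have mem: "z \<in> set w" "y \<in> set w" and
        cases: "(\<forall>c\<in>set w. z \<le> c \<and> c < y \<longrightarrow> (c, y) \<in> inversions w) \<or>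
                (\<forall>c\<in>set w. z < c \<and> c \<le> y \<longrightarrow> (z, c) \<in> inversions w)"
        unfolding forced_iff[OF w] by blast+
      have adw: "a \<in> set w" "d \<in> set w" using wm by simp_all
      from cases have "(a, d) \<in> forced w"
      proof
        \<comment> \<open>Here \<open>y\<close> precedes all letters of \<open>[z, y)\<close>. Since
          \<open>d\<close> is the first letter of the segment, this forces \<open>y = d\<close>.
          Dually, in the other case \<open>z\<close> must be the last letter
          \<open>a\<close>.\<close>
        assume *: "\<forall>c\<in>set w. z \<le> c \<and> c < y \<longrightarrow> (c, y) \<in> inversions w"
        have "y = d"
        proof (rule ccontr)
          assume ne: "y \<noteq> d"
          then have "z \<le> d" "d < y" using yz(2,3) by simp_all
          then have "(d, y) \<in> inversions w" using * adw(2) by blast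
          then have "(y, d) \<in> before w" by (simp add: inversions_def)
          moreover have "(d, y) \<in> before w" using ym ne wm by (auto simp: before_append)
          ultimately show False using before_asym[OF w] by blast
        qed
        then show ?thesis unfolding forced_iff[OF w] using * adw ad z by force
      next
        assume *: "\<forall>c\<in>set w. z < c \<and> c \<le> y \<longrightarrow> (z, c) \<in> inversions w"
        have "z = a"
        proof (rule ccontr)
          assume ne: "z \<noteq> a"
          then have "z < a" "a \<le> y" using z ad yz(2) by simp_all
          then have "(z, a) \<in> inversions w" using * adw(1) by blast
          then have "(a, z) \<in> before w" by (simp add: inversions_def)
          moreover have "(z, a) \<in> before w" using zm ne wm by (auto simp: before_append)
          ultimately show False using before_asym[OF w] by blast
        qed
        then show ?thesis unfolding forced_iff[OF w] using * adw ad yz(2) by force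
      qed
      then show ?thesis by (rule r_into_trancl)
    qed
  qed
  show ?thesis
  proof (rule subrelI)
    fix a d assume "(a, d) \<in> inversions w"
    then have "a < d" "(d, a) \<in> before w" by (simp_all add: inversions_def)
    then show "(a, d) \<in> (forced w)\<^sup>+" using before_split seg by metis
  qed
qed

lemma inversions_swap:
  assumes "distinct (u @ [a, b] @ v)" "a < b"
  shows "inversions (u @ [b, a] @ v) = insert (a, b) (inversions (u @ [a, b] @ v))"
    and "(a, b) \<notin> inversions (u @ [a, b] @ v)"
proof -
  have "(b, a) \<notin> before (u @ [a, b] @ v)"
    using before_asym[OF assms(1), of a b] by (simp add: before_append)
  then show "(a, b) \<notin> inversions (u @ [a, b] @ v)" by (simp add: inversions_def)
  show "inversions (u @ [b, a] @ v) = insert (a, b) (inversions (u @ [a, b] @ v))"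
    using assms(2) unfolding inversions_def before_swap[OF assms(1)] by auto
qed

lemma finite_inversions: "finite (inversions w)"
  by (rule finite_subset[OF inversions_subset]) simp

lemma forced_cong: "\<lbrakk>first w = first w'; first (rev w) = first (rev w')\<rbrakk> \<Longrightarrow> forced w = forced w'"
  by (simp add: forced_def)

text \<open>Descents that are not forced are undone one by one; this changes neither tree and lowers
  the number of inversions. When all descents are forced,
  \<open>inversions_subset_trancl_forced\<close> applies.\<close>

lemma exists_minimal:
  assumes "distinct w"
  shows "\<exists>\<mu>. distinct \<mu> \<and> set \<mu> = set w \<and> first \<mu> = first w \<and> first (rev \<mu>) = first (rev w) \<and>
    inversions \<mu> = (forced w)\<^sup>+"
  using assms
proof (induction "card (inversions w)" arbitrary: w rule: less_induct)
  case less
  show ?case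
  proof (cases "\<exists>u a d v. w = u @ [d, a] @ v \<and> a < d \<and> (a, d) \<notin> forced w")
    case False
    then have "inversions w \<subseteq> (forced w)\<^sup>+"
      using inversions_subset_trancl_forced[OF less.prems] by blast
    moreover have "(forced w)\<^sup>+ \<subseteq> inversions w"
      using trancl_mono_subset[OF forced_subset_inversions] trans_inversions[OF less.prems]
      by (metis trancl_id)
    ultimately show ?thesis using less.prems by blast
  next
    case True
    then obtain u a d v where w: "w = u @ [d, a] @ v" and ad: "a < d" "(a, d) \<notin> forced w" by blast
    define w' where "w' = u @ [a, d] @ v"
    have dw': "distinct w'" and sw': "set w' = set w" using less.prems by (auto simp: w w'_def)
    have invad: "(a, d) \<in> inversions w" using ad by (simp add: w inversions_def before_append)
    have dw: "a \<in> set w" "d \<in> set w" by (simp_all add: w)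
    obtain c where c: "c \<in> set w" "a \<le> c" "c < d" "(c, d) \<notin> inversions w"
      using ad dw unfolding forced_iff[OF less.prems] by blast
    obtain e where e: "e \<in> set w" "a < e" "e \<le> d" "(a, e) \<notin> inversions w"
      using ad dw unfolding forced_iff[OF less.prems] by blast
    have "c \<noteq> a" "e \<noteq> d" using c(4) e(4) invad by auto
    then have c': "a < c" and e': "e < d" using c(2) e(3) by simp_all
    \<comment> \<open>The failure of each half of \<open>forced\<close> gives a witness:
      \<open>c\<close> precedes both letters of the descent and \<open>e\<close> follows both. So
      \<open>c\<close> separates \<open>a\<close> from \<open>d\<close> in the left to right tree,
      and \<open>e\<close> does in the right to left tree.\<close>
    have "c \<in> set u" using c c' unfolding inversions_def by (auto simp: w before_append)
    moreover have "e \<in> set v" using e e' unfolding inversions_def by (auto simp: w before_append)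
    ultimately have fst: "first w' = first w" and snd: "first (rev w') = first (rev w)"
      using first_swap[of u a d v c] first_swap[of "rev v" d a "rev u" e] c' c(3) e(2) e' dw' ad(1)
      unfolding w w'_def by (auto simp: min_absorb1 max_absorb2 min_absorb2 max_absorb1)
    have "inversions w = insert (a, d) (inversions w')" "(a, d) \<notin> inversions w'"
      using inversions_swap[of u a d v] dw' ad(1) unfolding w w'_def by simp_all
    then have "card (inversions w') < card (inversions w)"
      by (simp add: finite_inversions)
    then obtain \<mu> where "distinct \<mu>" "set \<mu> = set w'" "first \<mu> = first w'" "first (rev \<mu>) = first (rev w')"
      "inversions \<mu> = (forced w')\<^sup>+"
      using less.hyps dw' by blast
    then show ?thesis using fst snd sw' forced_cong[OF fst snd] by auto
  qed
qed

section \<open>The permutohedron and Baxter orders\<close>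

lemma permutohedron_cover_inversions:
  "\<lbrakk>permutohedron_cover \<sigma> \<nu>; distinct \<sigma>\<rbrakk> \<Longrightarrow> inversions \<sigma> \<subseteq> inversions \<nu> \<and> distinct \<nu> \<and> set \<nu> = set \<sigma>"
proof (induction rule: permutohedron_cover.induct)
  case (1 a b u v)
  then show ?case using inversions_swap(1)[OF 1(2,1)] by auto
qed

lemma permutohedron_le_inversions:
  assumes "permutohedron_le \<sigma> \<nu>" "distinct \<sigma>"
  shows "inversions \<sigma> \<subseteq> inversions \<nu> \<and> distinct \<nu> \<and> set \<nu> = set \<sigma>"
  using assms(1) unfolding permutohedron_le_def
proof (induction rule: rtranclp_induct)
  case (step \<pi> \<rho>)
  then show ?case using permutohedron_cover_inversions by blast
qed (simp add: assms(2))

text \<open>If some ascent of \<sigma> is inverted in \<nu>, swapping it stays below \<nu> and comes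
  closer. If there is none, consecutive letters of \<sigma> have the same order in \<nu>, and
  transitivity gives equality.\<close>

lemma permutohedron_leI:
  assumes "distinct \<sigma>" "distinct \<nu>" "set \<sigma> = set \<nu>" "inversions \<sigma> \<subseteq> inversions \<nu>"
  shows "permutohedron_le \<sigma> \<nu>"
  using assms
proof (induction "card (inversions \<nu> - inversions \<sigma>)" arbitrary: \<sigma> rule: less_induct)
  case less
  show ?case
  proof (cases "\<exists>u a b v. \<sigma> = u @ [a, b] @ v \<and> a < b \<and> (a, b) \<in> inversions \<nu>")
    case True
    then obtain u a b v where \<sigma>: "\<sigma> = u @ [a, b] @ v" and ab: "a < b" "(a, b) \<in> inversions \<nu>" by blast
    let ?\<sigma> = "u @ [b, a] @ v"
    have d: "distinct ?\<sigma>" "set ?\<sigma> = set \<nu>" using less.prems by (auto simp: \<sigma>)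
    have inv: "inversions ?\<sigma> = insert (a, b) (inversions \<sigma>)" "(a, b) \<notin> inversions \<sigma>"
      using inversions_swap less.prems(1) ab(1) unfolding \<sigma> by blast+
    have "inversions \<nu> - inversions ?\<sigma> \<subset> inversions \<nu> - inversions \<sigma>"
      using inv ab(2) by auto
    then have "card (inversions \<nu> - inversions ?\<sigma>) < card (inversions \<nu> - inversions \<sigma>)"
      by (simp add: psubset_card_mono finite_inversions)
    moreover have "inversions ?\<sigma> \<subseteq> inversions \<nu>" using inv ab(2) less.prems(4) by simp
    ultimately have "permutohedron_le ?\<sigma> \<nu>" using less.hyps d less.prems(2) by blast
    moreover have "permutohedron_cover \<sigma> ?\<sigma>" unfolding \<sigma> using ab(1) by (rule permutohedron_cover.intros)
    ultimately show ?thesis unfolding permutohedron_le_def by (rule converse_rtranclp_into_rtranclp[rotated])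
  next
    case False
    have adj: "(x, y) \<in> before \<nu>" if "\<sigma> = u @ [x, y] @ v" for u x y v
    proof -
      have xy: "x \<noteq> y" "x \<in> set \<nu>" "y \<in> set \<nu>" using less.prems(1,3) that by auto
      have "(y, x) \<notin> before \<nu>"
      proof (cases "x < y")
        case True
        then show ?thesis using False that by (auto simp: inversions_def)
      next
        case nless: False
        then have "(y, x) \<in> inversions \<sigma>" using that xy(1) by (auto simp: inversions_def before_append)
        then have "(x, y) \<in> before \<nu>" using less.prems(4) by (auto simp: inversions_def)
        then show ?thesis using before_asym[OF less.prems(2)] by blast
      qed
      then show ?thesis using xy before_not_iff[OF less.prems(2)] by metis
    qed
    have "successively (\<lambda>x y. (x, y) \<in> before \<nu>) w" if "\<sigma> = u @ w" for u w
      using that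
    proof (induction w arbitrary: u)
      case (Cons x w)
      show ?case
      proof (cases w)
        case w: (Cons y v)
        have "(x, y) \<in> before \<nu>" using adj[of u x y v] Cons.prems w by simp
        then show ?thesis using Cons.IH[of "u @ [x]"] Cons.prems w by simp
      qed simp
    qed simp
    then have "successively (\<lambda>x y. (x, y) \<in> before \<nu>) \<sigma>" by (metis append_Nil)
    then have "sorted_wrt (\<lambda>x y. (x, y) \<in> before \<nu>) \<sigma>"
      by (subst (asm) successively_conv_sorted_wrt) (auto intro: transpI before_trans[OF less.prems(2)])
    then have "before \<sigma> \<subseteq> before \<nu>"
    proof (induction \<sigma>)
      case (Cons x w) then show ?case by auto
    qed simp
    have "inversions \<nu> = inversions \<sigma>"
    proof (rule equalityI)
      show "inversions \<nu> \<subseteq> inversions \<sigma>"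
      proof (rule subrelI)
        fix a b assume ab: "(a, b) \<in> inversions \<nu>"
        then have "(a, b) \<notin> before \<sigma>"
          using \<open>before \<sigma> \<subseteq> before \<nu>\<close> before_asym[OF less.prems(2)] by (auto simp: inversions_def)
        then have "(b, a) \<in> before \<sigma>"
          using before_not_iff[OF less.prems(1), of a b] ab before_in_set[of b a \<nu>] less.prems(3)
          by (auto simp: inversions_def)
        then show "(a, b) \<in> inversions \<sigma>" using ab by (simp add: inversions_def)
      qed
    qed (rule less.prems(4))
    then have "\<sigma> = \<nu>" using inversions_inj less.prems by metis
    then show ?thesis by (simp add: permutohedron_le_def)
  qed
qed

section \<open>Twin binary trees are the images of the permutations\<close>

lemma length_leaf_word [simp]: "length (leaf_word d t) = Suc (size t)"
  by (induction d t rule: leaf_word.induct) simp_all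

lemma leaf_word_shape [simp]: "leaf_word d (shape t) = leaf_word d t"
  unfolding shape_def by (induction d t rule: leaf_word.induct) simp_all

lemma hd_leaf_word: "t \<noteq> Leaf \<Longrightarrow> leaf_word d t ! 0 = 1"
proof (induction d t rule: leaf_word.induct)
  case (2 d l x r)
  then show ?case by (cases l) (simp_all add: nth_append)
qed simp

lemma last_leaf_word: "t \<noteq> Leaf \<Longrightarrow> leaf_word d t ! size t = 0"
proof (induction d t rule: leaf_word.induct)
  case (2 d l x r)
  then show ?case by (cases r) (simp_all add: nth_append)
qed simp

text \<open>This leaf lies between nodes \<open>i\<close> and \<open>i + 1\<close> of the inorder
  list, one of which is an ancestor of the other. It hangs from the lower one: as left child of node
  \<open>i + 1\<close> or as right child of node \<open>i\<close>. The first and last leaves, which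
  lack one neighbour, are excluded by \<open>Suc\<close> and by the bound.\<close>

lemma leaf_word_nth:
  assumes "bst t" "Suc i < size t"
  shows "leaf_word d t ! Suc i = (if (inorder t ! i, inorder t ! Suc i) \<in> ancestors t then 1 else 0)"
  using assms
proof (induction d t arbitrary: i rule: leaf_word.induct)
  case (2 d l x r)
  let ?t = "Node l x r"
  have bl: "bst l" and br: "bst r" using "2.prems"(1) by simp_all
  consider (left) "Suc i < size l" | (last) "Suc i = size l" | (root) "i = size l"
    | (right) j where "i = Suc (size l + j)"
    by (metis less_iff_Suc_add nat_neq_iff not_less_eq add_Suc_right)
  then show ?case
  proof cases
    case left
    then have "inorder ?t ! i = inorder l ! i" "inorder ?t ! Suc i = inorder l ! Suc i"
      by (simp_all add: nth_append)
    moreover have "inorder l ! i \<in> set_tree l" "inorder l ! Suc i \<in> set_tree l"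
      using left by (metis Suc_lessD length_inorder nth_mem set_inorder)+
    ultimately have "(inorder ?t ! i, inorder ?t ! Suc i) \<in> ancestors ?t \<longleftrightarrow>
        (inorder l ! i, inorder l ! Suc i) \<in> ancestors l"
      using "2.prems"(1) by (subst ancestors_Node(1)[OF "2.prems"(1)]) simp
    then show ?thesis using "2.IH"(1)[OF bl left] left by (simp add: nth_append)
  next
    case last
    then have "inorder ?t ! i \<in> set_tree l" "inorder ?t ! Suc i = x"
      by (metis inorder.simps(2) length_inorder lessI nth_append nth_mem set_inorder)
        (simp add: last nth_append)
    then have "(inorder ?t ! i, inorder ?t ! Suc i) \<notin> ancestors ?t"
      using "2.prems"(1) ancestors_subset[of l] ancestors_subset[of r] by fastforce
    moreover have "leaf_word 1 l ! Suc i = 0" using last_leaf_word[of l 1] last by force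
    ultimately show ?thesis using last by (simp add: nth_append)
  next
    case root
    then have "r \<noteq> Leaf" using "2.prems"(2) by auto
    moreover have "inorder ?t ! i = x" using root by (simp add: nth_append)
    moreover have "inorder ?t ! Suc i \<in> set_tree ?t"
      using "2.prems"(2) by (metis length_inorder nth_mem set_inorder)
    ultimately have "(inorder ?t ! i, inorder ?t ! Suc i) \<in> ancestors ?t" by auto
    then show ?thesis using root hd_leaf_word[of r 0] \<open>r \<noteq> Leaf\<close> by (simp add: nth_append)
  next
    case right
    then have j: "Suc j < size r" using "2.prems"(2) by simp
    have *: "inorder ?t ! i = inorder r ! j" "inorder ?t ! Suc i = inorder r ! Suc j"
      using right by (simp_all add: nth_append)
    moreover have "inorder r ! j \<in> set_tree r" "inorder r ! Suc j \<in> set_tree r"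
      using j by (metis Suc_lessD length_inorder nth_mem set_inorder)+
    ultimately have "(inorder ?t ! i, inorder ?t ! Suc i) \<in> ancestors ?t \<longleftrightarrow>
        (inorder r ! j, inorder r ! Suc j) \<in> ancestors r"
      using "2.prems"(1) by (subst ancestors_Node(2)[OF "2.prems"(1)]) simp
    then show ?thesis using "2.IH"(2)[OF br j] right by (simp add: nth_append)
  qed
qed simp

lemma canopy_nth:
  assumes "bst t" "Suc i < size t"
  shows "canopy t ! i = (if (inorder t ! i, inorder t ! Suc i) \<in> ancestors t then 1 else 0)"
  using leaf_word_nth[OF assms, of 0] assms(2)
  by (simp add: canopy_def nth_butlast nth_tl)

lemma first_consecutive:
  assumes "distinct w" "a \<in> set w" "b \<in> set w" "a \<noteq> b"
    "\<And>c. c \<in> set w \<Longrightarrow> \<not> (min a b < c \<and> c < max a b)"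
  shows "(a, b) \<in> first w \<longleftrightarrow> (a, b) \<in> before w"
proof
  assume "(a, b) \<in> first w"
  then show "(a, b) \<in> before w" using assms(3,4) by (auto simp: first_def)
next
  assume "(a, b) \<in> before w"
  moreover have "c = a \<or> c = b" if "c \<in> set w" "min a b \<le> c" "c \<le> max a b" for c
    using assms(5)[OF that(1)] that(2,3) by (auto simp: min_def max_def split: if_splits)
  ultimately show "(a, b) \<in> first w" using assms(2,3) unfolding first_def by blast
qed

text \<open>Entry \<open>i\<close>, counted from 0, compares the values \<open>i + 1\<close> and
  \<open>i + 2\<close>. The canopy thus records which of two neighbouring values comes first, and
  reversing the word flips every entry: this is the source of the twin condition.\<close>

lemma canopy_bst_of:
  assumes "\<sigma> \<in> perms" "Suc i < length \<sigma>"
  shows "canopy (bst_of \<sigma>) ! i = (if (Suc i, Suc (Suc i)) \<in> before \<sigma> then 1 else 0)"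
proof -
  have \<sigma>: "distinct \<sigma>" "set \<sigma> = {1..length \<sigma>}" using assms(1) by (simp_all add: perms_def)
  have "inorder (bst_of \<sigma>) ! i = Suc i" "inorder (bst_of \<sigma>) ! Suc i = Suc (Suc i)"
    using assms(2) unfolding inorder_bst_of_perm[OF assms(1)] by (simp_all del: upt_Suc)
  moreover have "(Suc i, Suc (Suc i)) \<in> first \<sigma> \<longleftrightarrow> (Suc i, Suc (Suc i)) \<in> before \<sigma>"
    using assms(2) by (intro first_consecutive \<sigma>(1)) (auto simp: \<sigma>(2))
  ultimately show ?thesis
    using assms(2) \<sigma>(1) by (simp add: canopy_nth bst_bst_of ancestors_bst_of)
qed

lemma canopy_shape [simp]: "canopy (shape t) = canopy t"
  by (simp add: canopy_def)

lemma twin_P_symbol: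
  assumes "\<sigma> \<in> perms"
  shows "twin (P_symbol \<sigma>)"
proof -
  have "canopy (bst_of \<sigma>) ! i \<noteq> canopy (bst_of (rev \<sigma>)) ! i" if "i < length \<sigma> - 1" for i
  proof -
    have i: "Suc i < length \<sigma>" using that by simp
    have "Suc i \<in> set \<sigma>" "Suc (Suc i) \<in> set \<sigma>" "distinct \<sigma>"
      using assms i by (simp_all add: perms_def)
    then have "(Suc (Suc i), Suc i) \<in> before \<sigma> \<longleftrightarrow> (Suc i, Suc (Suc i)) \<notin> before \<sigma>"
      using before_not_iff by (metis n_not_Suc_n)
    then show ?thesis using canopy_bst_of[of \<sigma> i] canopy_bst_of[of "rev \<sigma>" i] assms i by simp
  qed
  then show ?thesis by (simp add: twin_def P_symbol_def)
qed

section \<open>From a twin pair to a permutation\<close>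

lemma exists_labelling: "length xs = size t \<Longrightarrow> \<exists>t'. shape t' = t \<and> inorder t' = xs"
proof (induction t arbitrary: xs)
  case Leaf
  then show ?case by (intro exI[of _ Leaf]) (simp add: shape_def)
next
  case (Node l u r)
  then have len: "length xs = size l + Suc (size r)" by simp
  obtain l' where l': "shape l' = l" "inorder l' = take (size l) xs"
    using Node.IH(1)[of "take (size l) xs"] len by auto
  obtain r' where r': "shape r' = r" "inorder r' = drop (Suc (size l)) xs"
    using Node.IH(2)[of "drop (Suc (size l)) xs"] len by auto
  have "inorder (Node l' (xs ! size l) r') = xs"
    using l' r' len id_take_nth_drop[of "size l" xs] by simp
  moreover have "shape (Node l' (xs ! size l) r') = Node l u r"
    using l' r' by (simp add: shape_def)
  ultimately show ?case by blast
qed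

text \<open>In preorder each root precedes its descendants, and filtering below and above the root
  gives back the preorders of the subtrees. This supplies a word with a prescribed tree.\<close>

lemma bst_of_preorder: "bst t \<Longrightarrow> distinct (preorder t) \<and> bst_of (preorder t) = t"
proof (induction t)
  case Leaf
  then show ?case by (simp add: bst_of_def)
next
  case (Node l x r)
  have l: "y < x" if "y \<in> set_tree l" for y using Node.prems that by simp
  have r: "x < y" if "y \<in> set_tree r" for y using Node.prems that by simp
  have dis: "distinct (preorder l)" "distinct (preorder r)" using Node by simp_all
  have x: "x \<notin> set (preorder l @ preorder r)" using l r by force
  have "set_tree l \<inter> set_tree r = {}" using l r by force
  then have "distinct (preorder (Node l x r))" using dis x by simp
  moreover have "filter (\<lambda>y. y < x) (preorder l @ preorder r) = preorder l"
    using l r by (simp add: filter_empty_conv) (metis filter_True less_asym set_preorder)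
  moreover have "filter (\<lambda>y. x < y) (preorder l @ preorder r) = preorder r"
    using l r by (simp add: filter_empty_conv) (metis append_Nil filter_True filter_False less_asym set_preorder)
  ultimately show ?case using Node x by (simp add: bst_of_Cons)
qed

text \<open>Neighbouring values relative to a set: the induction below removes letters, after which
  neighbours need no longer differ by one.\<close>

definition adjacent_in :: "'a::linorder set \<Rightarrow> 'a \<Rightarrow> 'a \<Rightarrow> bool" where
  "adjacent_in S a b \<longleftrightarrow> a \<in> S \<and> b \<in> S \<and> a < b \<and> (\<forall>c\<in>S. \<not> (a < c \<and> c < b))"

lemma adjacent_below:
  assumes "finite S" "x \<in> S" "p \<in> S" "p < x"
  shows "\<exists>y. adjacent_in S y x \<and> p \<le> y"
proof -
  let ?B = "{y \<in> S. y < x}"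
  have fin: "finite ?B" and ne: "p \<in> ?B" using assms by simp_all
  have "?B \<noteq> {}" using ne by blast
  then have "Max ?B \<in> ?B" using fin by (rule Max_in[rotated])
  moreover have "c \<le> Max ?B" if "c \<in> S" "c < x" for c using that fin by simp
  ultimately have "adjacent_in S (Max ?B) x"
    using assms(2) unfolding adjacent_in_def by (auto simp: not_less[symmetric])
  moreover have "p \<le> Max ?B" using fin ne by (rule Max_ge)
  ultimately show ?thesis by blast
qed

lemma adjacent_above:
  assumes "finite S" "x \<in> S" "p \<in> S" "x < p"
  shows "\<exists>y. adjacent_in S x y \<and> y \<le> p"
proof -
  let ?B = "{y \<in> S. x < y}"
  have fin: "finite ?B" and ne: "p \<in> ?B" using assms by simp_all
  have "?B \<noteq> {}" using ne by blast
  then have "Min ?B \<in> ?B" using fin by (rule Min_in[rotated])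
  moreover have "Min ?B \<le> c" if "c \<in> S" "x < c" for c using that fin by simp
  ultimately have "adjacent_in S x (Min ?B)"
    using assms(2) unfolding adjacent_in_def by (auto simp: not_less[symmetric])
  moreover have "Min ?B \<le> p" using fin ne by (rule Min_le)
  ultimately show ?thesis by blast
qed

lemma exists_neighbour:
  assumes "finite S" "x \<in> S" "p \<in> S" "p \<noteq> x"
  shows "\<exists>y. (adjacent_in S y x \<or> adjacent_in S x y) \<and> min p x \<le> y \<and> y \<le> max p x"
proof (cases "p < x")
  case True
  then obtain y where "adjacent_in S y x" "p \<le> y" using adjacent_below assms by blast
  then show ?thesis using True by (intro exI[of _ y]) (auto simp: adjacent_in_def)
next
  case False
  then have "x < p" using assms(4) by simp
  then obtain y where "adjacent_in S x y" "y \<le> p" using adjacent_above assms by blast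
  then show ?thesis using \<open>x < p\<close> by (intro exI[of _ y]) (auto simp: adjacent_in_def)
qed

text \<open>The hypothesis makes \<open>P\<close> order-convex, so an interval between two selected
  letters loses nothing.\<close>

lemma first_filter:
  assumes "\<And>a b c. \<lbrakk>P a; P b; min a b \<le> c; c \<le> max a b\<rbrakk> \<Longrightarrow> P c"
  shows "first (filter P w) = {(a, b) \<in> first w. P a \<and> P b}"
proof -
  have "(a, b) \<in> first (filter P w) \<longleftrightarrow> (a, b) \<in> first w \<and> P a \<and> P b" for a b
    using assms[of a b] by (auto simp: first_def before_filter)
  then show ?thesis by auto
qed

text \<open>Through the trees: inserting the last letter depends only on the tree built so
  far.\<close>

lemma first_snoc_cong:
  assumes "distinct (w @ [x])" "distinct (w' @ [x])" "first w = first w'"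
  shows "first (w @ [x]) = first (w' @ [x])"
proof -
  have "bst_of w = bst_of w'" using assms bst_of_eq_iff[of w w'] by simp
  then have "bst_of (w @ [x]) = bst_of (w' @ [x])" by (simp add: bst_of_def)
  then show ?thesis using assms(1,2) bst_of_eq_iff by metis
qed

lemma first_Cons_cong:
  assumes "x \<notin> set w" "x \<notin> set w'" "set w = set w'"
    "first (filter (\<lambda>y. y < x) w) = first (filter (\<lambda>y. y < x) w')"
    "first (filter (\<lambda>y. x < y) w) = first (filter (\<lambda>y. x < y) w')"
  shows "first (x # w) = first (x # w')"
  using assms by (simp add: first_Cons)

text \<open>Such an \<open>x\<close> has no proper descendant, since it would have to precede a
  neighbour; so it can be inserted last. For other letters \<open>p\<close>, an interval from
  \<open>p\<close> that contains \<open>x\<close> also contains a neighbour of \<open>x\<close>, and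
  \<open>p\<close> precedes \<open>x\<close> as soon as it precedes or equals that
  neighbour.\<close>

lemma first_move_last:
  assumes "distinct u" "x \<in> set u"
    and nb: "\<And>y. adjacent_in (set u) y x \<or> adjacent_in (set u) x y \<Longrightarrow> (y, x) \<in> before u"
  shows "first u = first (filter (\<lambda>y. y \<noteq> x) u @ [x])"
proof -
  let ?u = "filter (\<lambda>y. y \<noteq> x) u @ [x]"
  have s: "set ?u = set u" using assms(2) by auto
  have bef: "(p, q) \<in> before ?u \<longleftrightarrow> p \<in> set u \<and> p \<noteq> x \<and> (q = x \<or> (p, q) \<in> before u)" for p q
    by (auto simp: before_append before_filter dest: before_in_set)
  have "(\<forall>c\<in>set u. min p q \<le> c \<and> c \<le> max p q \<longrightarrow> c = p \<or> (p, c) \<in> before u) \<longleftrightarrow>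
        (\<forall>c\<in>set u. min p q \<le> c \<and> c \<le> max p q \<longrightarrow> c = p \<or> (p, c) \<in> before ?u)" (is "?L \<longleftrightarrow> ?R")
    if pS: "p \<in> set u" and qS: "q \<in> set u" for p q
  proof (cases "p = x")
    case True
    show ?thesis
    proof (cases "q = x")
      case False
      have "\<not> ?R" using False True qS bef by (auto simp: min_def max_def)
      obtain y where y: "adjacent_in (set u) y x \<or> adjacent_in (set u) x y" "min p q \<le> y" "y \<le> max p q"
        using exists_neighbour[OF _ assms(2) qS False] True by (metis List.finite_set max.commute min.commute)
      then have "(x, y) \<notin> before u" using nb before_asym[OF assms(1)] by blast
      moreover have "y \<in> set u" "y \<noteq> x" using y(1) by (auto simp: adjacent_in_def)
      ultimately have "\<not> ?L" using y True by blast
      then show ?thesis using \<open>\<not> ?R\<close> by blast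
    qed (use True in auto)
  next
    case px: False
    show ?thesis
    proof
      assume ?L then show ?R using bef px pS by blast
    next
      assume R: ?R
      show ?L
      proof (intro ballI impI)
        fix c assume c: "c \<in> set u" "min p q \<le> c \<and> c \<le> max p q"
        show "c = p \<or> (p, c) \<in> before u"
        proof (cases "c = x")
          case False
          then show ?thesis using R c bef by blast
        next
          case True
          obtain y where y: "adjacent_in (set u) y x \<or> adjacent_in (set u) x y" "min p x \<le> y" "y \<le> max p x"
            using exists_neighbour[OF _ assms(2) pS px] by auto
          have y': "min p q \<le> y" "y \<le> max p q"
            using y(2,3) c(2) True by (auto simp: min_def max_def split: if_splits)
          have yx: "(y, x) \<in> before u" "y \<in> set u" "y \<noteq> x" using nb y(1) by (auto simp: adjacent_in_def)
          then have "y = p \<or> (p, y) \<in> before u" using R y' bef by blast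
          then show ?thesis using yx(1) True before_trans[OF assms(1)] by blast
        qed
      qed
    qed
  qed
  then show ?thesis unfolding first_def s by auto
qed

text \<open>Induction on the words, removing the last letter \<open>x\<close> of \<open>v\<close>. The neighbours of \<open>x\<close> precede it
  in \<open>v\<close>, hence in \<open>u\<close>, so that \<open>x\<close> can be moved to the end of \<open>u\<close>. In the right to left search
  tree the letters below \<open>x\<close> and those above \<open>x\<close> are independent; of their two concatenations one
  agrees with \<open>u\<close> on the two neighbours of \<open>x\<close>, which have become adjacent.\<close>
lemma exists_common_word:
  assumes "distinct u" "distinct v" "set u = set v"
    and "\<And>a b. adjacent_in (set u) a b \<Longrightarrow> (a, b) \<in> before u \<longleftrightarrow> (a, b) \<in> before v"
  shows "\<exists>w. distinct w \<and> set w = set u \<and> first w = first u \<and> first (rev w) = first (rev v)"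
  using assms
proof (induction "length v" arbitrary: u v)
  case 0
  then show ?case by (intro exI[of _ "[]"]) simp
next
  case (Suc n)
  then obtain v' x where v: "v = v' @ [x]" by (cases v rule: rev_cases) simp_all
  define u' where "u' = filter (\<lambda>y. y \<noteq> x) u"
  define low where "low = filter (\<lambda>y. y < x) v'"
  define high where "high = filter (\<lambda>y. x < y) v'"
  define S where "S = set v'"
  have du: "distinct u" and dv: "distinct v" and suv: "set u = set v" using Suc.prems by simp_all
  have xv: "x \<notin> S" and dv': "distinct v'" and xu: "x \<in> set u" using dv suv by (simp_all add: v S_def)
  have su: "set u = insert x S" using suv v by (simp add: S_def)
  have su': "set u' = S" using su xv by (auto simp: u'_def)
  have du': "distinct u'" using du by (simp add: u'_def)
  have nb: "(y, x) \<in> before u" if "adjacent_in (set u) y x \<or> adjacent_in (set u) x y" for y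
  proof -
    have y: "y \<in> S" "y \<noteq> x" using that su by (auto simp: adjacent_in_def)
    then have yv: "(y, x) \<in> before v" by (simp add: v before_append S_def)
    show ?thesis
    proof (cases "adjacent_in (set u) y x")
      case True
      then show ?thesis using Suc.prems(4) yv by blast
    next
      case False
      then have "(x, y) \<notin> before u" using that Suc.prems(4) yv before_asym[OF dv] by blast
      then show ?thesis using before_not_iff[OF du] y su by blast
    qed
  qed
  have first_u: "first u = first (u' @ [x])"
    unfolding u'_def by (rule first_move_last[OF du xu nb])
  \<comment> \<open>At most one adjacent pair \<open>y\<close>, \<open>z\<close> straddles
    \<open>x\<close>, so a single choice of order suffices. If there is none, \<open>low\<close> or
    \<open>high\<close> is empty.\<close>
  define v2 where "v2 = (if \<forall>y z. adjacent_in S y z \<and> y < x \<and> x < z \<longrightarrow> (y, z) \<in> before u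
     then low @ high else high @ low)"
  have sl: "set low = {y \<in> S. y < x}" and sh: "set high = {y \<in> S. x < y}"
    by (simp_all add: low_def high_def S_def)
  have sv2: "set v2 = S" using split_letters[of x v'] xv sl sh by (auto simp: v2_def S_def)
  have "distinct low" "distinct high" "set low \<inter> set high = {}"
    using dv' by (auto simp: low_def high_def)
  then have dv2: "distinct v2" by (auto simp: v2_def)
  have "n = length v'" using Suc.hyps(2) v by simp
  also have "\<dots> = length v2" using distinct_card[OF dv'] distinct_card[OF dv2] sv2 by (simp add: S_def)
  finally have n: "n = length v2" .
  have u'_iff: "(a, b) \<in> before u' \<longleftrightarrow> (a, b) \<in> before u" if "a \<in> S" "b \<in> S" for a b
    using that xv by (auto simp: u'_def before_filter)
  have adj: "(a, b) \<in> before u' \<longleftrightarrow> (a, b) \<in> before v2" if ab: "adjacent_in (set u') a b" for a b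
  proof -
    have abS: "adjacent_in S a b" using ab su' by simp
    then have mem: "a \<in> S" "b \<in> S" "a \<noteq> x" "b \<noteq> x" "a < b" using xv by (auto simp: adjacent_in_def)
    show ?thesis
    proof (cases "a < x \<and> x < b")
      case True
      have notin: "a \<notin> set high" "b \<notin> set low" "a \<in> set low" "b \<in> set high"
        using True mem(1,2) unfolding sl sh by (simp_all add: less_imp_not_less)
      show ?thesis
      proof (cases "\<forall>y z. adjacent_in S y z \<and> y < x \<and> x < z \<longrightarrow> (y, z) \<in> before u")
        case all: True
        then have "(a, b) \<in> before u" using abS True by blast
        moreover have "(a, b) \<in> before v2" using all notin by (simp add: v2_def before_append)
        ultimately show ?thesis using u'_iff mem by blast
      next
        case False
        then obtain y z where yz: "adjacent_in S y z" "y < x" "x < z" "(y, z) \<notin> before u" by blast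
        have "\<not> y < a" "\<not> a < y" "\<not> b < z" "\<not> z < b"
          using yz abS True unfolding adjacent_in_def by (meson less_trans)+
        then have "y = a" "z = b" by simp_all
        then have "(a, b) \<notin> before u" using yz by simp
        moreover have "v2 = high @ low" unfolding v2_def by (rule if_not_P[OF False])
        then have "(a, b) \<notin> before v2" using notin by (auto simp: before_append dest: before_in_set)
        ultimately show ?thesis using u'_iff mem by blast
      qed
    next
      case False
      then have side: "(a < x \<and> b < x) \<or> (x < a \<and> x < b)" using mem by auto
      then have "adjacent_in (set u) a b" using abS by (auto simp: adjacent_in_def su)
      then have "(a, b) \<in> before u \<longleftrightarrow> (a, b) \<in> before v" by (rule Suc.prems(4))
      also have "\<dots> \<longleftrightarrow> (a, b) \<in> before v'" using mem by (auto simp: v before_append)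
      also have "\<dots> \<longleftrightarrow> (a, b) \<in> before low \<or> (a, b) \<in> before high"
        using side by (auto simp: low_def high_def before_filter)
      also have "\<dots> \<longleftrightarrow> (a, b) \<in> before v2"
        using side by (auto simp: v2_def before_append sl sh)
      finally show ?thesis using u'_iff mem by blast
    qed
  qed
  obtain w where w: "distinct w" "set w = S" "first w = first u'" "first (rev w) = first (rev v2)"
    using Suc.hyps(1)[OF n du' dv2 _ adj] su' sv2 by auto
  have convex: "first (filter (\<lambda>y. y < x) w) = {(a, b) \<in> first w. a < x \<and> b < x}"
       "first (filter (\<lambda>y. x < y) w) = {(a, b) \<in> first w. x < a \<and> x < b}" for w :: "'a list"
    by (rule first_filter; auto simp: min_def max_def split: if_splits)+
  have filters: "filter (\<lambda>y. y < x) (rev v2) = filter (\<lambda>y. y < x) (rev v')"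
      "filter (\<lambda>y. x < y) (rev v2) = filter (\<lambda>y. x < y) (rev v')"
    by (auto simp: v2_def low_def high_def rev_filter[symmetric] filter_empty_conv
        intro!: filter_cong)
  have "first (w @ [x]) = first u"
    unfolding first_u using w du' su' xv by (intro first_snoc_cong) simp_all
  moreover have "first (rev (w @ [x])) = first (rev v)"
  proof -
    \<comment> \<open>Read from the right, \<open>x\<close> is the root, and the letters below and
      above it go to separate subtrees. Their interleaving is lost, so \<open>v2\<close> serves as
      well as \<open>v'\<close>.\<close>
    have "first (x # rev w) = first (x # rev v')"
      using w(2) xv by (intro first_Cons_cong)
        (simp_all add: S_def convex(1)[of "rev w"] convex(2)[of "rev w"] w(4)
          convex[symmetric] filters)
    then show ?thesis by (simp add: v)
  qed
  moreover have "distinct (w @ [x])" "set (w @ [x]) = set u" using w xv su by simp_all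
  ultimately show ?case by blast
qed

text \<open>One word is taken for each tree. By \<open>canopy_bst_of\<close> the twin condition says
  that the two words order all neighbouring values alike, and \<open>exists_common_word\<close>
  merges them.\<close>

lemma P_symbol_surj:
  assumes "twin J"
  shows "\<exists>\<sigma>\<in>perms. P_symbol \<sigma> = J"
proof -
  obtain s t where J: "J = (s, t)" by (cases J)
  define n where "n = size s"
  have nt: "size t = n" using assms by (simp add: twin_def J n_def)
  obtain s' where s': "shape s' = s" "inorder s' = [1..<Suc n]"
    using exists_labelling[of "[1..<Suc n]" s] by (auto simp: n_def simp del: upt_Suc)
  obtain t' where t': "shape t' = t" "inorder t' = [1..<Suc n]"
    using exists_labelling[of "[1..<Suc n]" t] by (auto simp: nt simp del: upt_Suc)
  \<comment> \<open>\<open>v\<close> is reversed because the second tree arises by insertion from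
    right to left.\<close>
  define u v where "u = preorder s'" and "v = rev (preorder t')"
  have "bst s'" "bst t'" using s' t' by (simp_all add: bst_iff_sorted_wrt_less del: upt_Suc)
  then have u: "distinct u" "bst_of u = s'" and v: "distinct v" "bst_of (rev v) = t'"
    using bst_of_preorder by (auto simp: u_def v_def)
  have len: "length u = n" "length v = n"
    using size_shape[of s'] size_shape[of t'] s' t' nt by (simp_all add: u_def v_def n_def)
  have "set u = set (inorder s')" "set v = set (inorder t')" by (simp_all add: u_def v_def)
  then have sets: "set u = {1..n}" "set v = {1..n}" using s' t' by auto
  have perms: "u \<in> perms" "v \<in> perms" using u v len sets by (simp_all add: perms_def)
  have "(a, b) \<in> before u \<longleftrightarrow> (a, b) \<in> before v" if ab: "adjacent_in (set u) a b" for a b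
  proof -
    have "b = Suc a"
    proof (rule ccontr)
      assume "b \<noteq> Suc a"
      then have "Suc a \<in> set u" "a < Suc a" "Suc a < b" using ab sets by (auto simp: adjacent_in_def)
      then show False using ab by (auto simp: adjacent_in_def)
    qed
    moreover have mem: "a \<in> set u" "b \<in> set u" using ab by (simp_all add: adjacent_in_def)
    ultimately obtain i where i: "a = Suc i" "b = Suc (Suc i)" "Suc i < n"
      using sets by (cases a) auto
    have "canopy s ! i \<noteq> canopy t ! i" using assms i(3) by (simp add: twin_def J n_def)
    then have "canopy (bst_of u) ! i \<noteq> canopy (bst_of (rev v)) ! i"
      using u(2) v(2) s'(1) t'(1) canopy_shape by metis
    then have "(a, b) \<in> before u \<longleftrightarrow> (b, a) \<notin> before v"
      using canopy_bst_of[OF perms(1)] canopy_bst_of[of "rev v" i] perms(2) len i by (auto split: if_splits)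
    then show ?thesis using before_not_iff[OF v(1), of b a] mem sets i by auto
  qed
  then obtain w where w: "distinct w" "set w = set u" "first w = first u" "first (rev w) = first (rev v)"
    using exists_common_word[of u v] u v sets by auto
  have "length w = n" using distinct_card[OF w(1)] distinct_card[OF u(1)] w(2) len by simp
  then have "w \<in> perms" using w sets by (simp add: perms_def)
  moreover have "bst_of w = s'" using bst_of_eq_iff[OF w(1) u(1)] w(3) u(2) by simp
  moreover have "bst_of (rev w) = t'" using bst_of_eq_iff[of "rev w" "rev v"] w v by simp
  ultimately show ?thesis using s' t' by (intro bexI[of _ w]) (simp_all add: P_symbol_def J)
qed

section \<open>The Baxter order through forced inversions\<close>

lemma length_eq_of_P_symbol_eq: "P_symbol \<sigma> = P_symbol \<nu> \<Longrightarrow> length \<sigma> = length \<nu>"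
  by (metis size_P_symbol(1))

lemma set_perm: "\<sigma> \<in> perms \<Longrightarrow> set \<sigma> = {1..length \<sigma>}"
  and distinct_perm: "\<sigma> \<in> perms \<Longrightarrow> distinct \<sigma>"
  by (simp_all add: perms_def)

lemma forced_P_symbol:
  "\<lbrakk>P_symbol \<sigma> = P_symbol \<nu>; \<sigma> \<in> perms; \<nu> \<in> perms\<rbrakk> \<Longrightarrow> forced \<sigma> = forced \<nu>"
  using P_symbol_eq_iff forced_cong by blast

lemma exists_minimal_perm:
  assumes "\<sigma> \<in> perms"
  shows "\<exists>\<mu>\<in>perms. P_symbol \<mu> = P_symbol \<sigma> \<and> inversions \<mu> = (forced \<sigma>)\<^sup>+"
proof -
  obtain \<mu> where \<mu>: "distinct \<mu>" "set \<mu> = set \<sigma>" "first \<mu> = first \<sigma>" "first (rev \<mu>) = first (rev \<sigma>)"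
    "inversions \<mu> = (forced \<sigma>)\<^sup>+"
    using exists_minimal[OF distinct_perm[OF assms]] by blast
  have "length \<mu> = length \<sigma>"
    using distinct_card[OF \<mu>(1)] distinct_card[OF distinct_perm[OF assms]] \<mu>(2) by simp
  then have "\<mu> \<in> perms" using \<mu>(1,2) assms by (simp add: perms_def)
  then show ?thesis using \<mu> P_symbol_eq_iff[OF _ assms] by blast
qed

lemma trancl_forced_subset:
  "\<lbrakk>forced \<sigma> \<subseteq> inversions \<nu>; distinct \<nu>\<rbrakk> \<Longrightarrow> (forced \<sigma>)\<^sup>+ \<subseteq> inversions \<nu>"
  using trancl_mono_subset trans_inversions by (metis trancl_id)

text \<open>The forced inversions determine the least permutation of the class, hence the class. The
  length must be given too: every increasing permutation has \<open>forced\<close> empty.\<close>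

lemma P_symbol_eq_iff_forced:
  assumes "\<sigma> \<in> perms" "\<nu> \<in> perms"
  shows "P_symbol \<sigma> = P_symbol \<nu> \<longleftrightarrow> length \<sigma> = length \<nu> \<and> forced \<sigma> = forced \<nu>"
proof
  assume "P_symbol \<sigma> = P_symbol \<nu>"
  then show "length \<sigma> = length \<nu> \<and> forced \<sigma> = forced \<nu>"
    using length_eq_of_P_symbol_eq forced_P_symbol assms by blast
next
  assume eq: "length \<sigma> = length \<nu> \<and> forced \<sigma> = forced \<nu>"
  obtain \<mu> where \<mu>: "\<mu> \<in> perms" "P_symbol \<mu> = P_symbol \<sigma>" "inversions \<mu> = (forced \<sigma>)\<^sup>+"
    using exists_minimal_perm[OF assms(1)] by blast
  obtain \<mu>' where \<mu>': "\<mu>' \<in> perms" "P_symbol \<mu>' = P_symbol \<nu>" "inversions \<mu>' = (forced \<nu>)\<^sup>+"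
    using exists_minimal_perm[OF assms(2)] by blast
  have "length \<mu> = length \<mu>'"
    using length_eq_of_P_symbol_eq[OF \<mu>(2)] length_eq_of_P_symbol_eq[OF \<mu>'(2)] eq by simp
  then have "\<mu> = \<mu>'"
    using \<mu> \<mu>' eq by (intro inversions_inj) (simp_all add: distinct_perm set_perm)
  then show "P_symbol \<sigma> = P_symbol \<nu>" using \<mu>(2) \<mu>'(2) by simp
qed

lemma baxter_le_forced:
  assumes "baxter_le (P_symbol \<sigma>) (P_symbol \<nu>)" "\<sigma> \<in> perms" "\<nu> \<in> perms"
  shows "length \<sigma> = length \<nu>" "forced \<sigma> \<subseteq> forced \<nu>"
proof -
  obtain \<sigma>' \<nu>' where *: "\<sigma>' \<in> perms" "\<nu>' \<in> perms" "permutohedron_le \<sigma>' \<nu>'"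
    "P_symbol \<sigma>' = P_symbol \<sigma>" "P_symbol \<nu>' = P_symbol \<nu>"
    using assms(1) unfolding baxter_le_def by blast
  show "length \<sigma> = length \<nu>"
    using length_eq_of_P_symbol_eq[OF *(4)] length_eq_of_P_symbol_eq[OF *(5)]
      permutohedron_le_length[OF *(3)] by simp
  have "forced \<sigma>' \<subseteq> forced \<nu>'"
    using forced_mono[OF distinct_perm[OF *(1)] distinct_perm[OF *(2)]]
      permutohedron_le_inversions[OF *(3) distinct_perm[OF *(1)]] by simp
  then show "forced \<sigma> \<subseteq> forced \<nu>"
    using forced_P_symbol[OF *(4,1) assms(2)] forced_P_symbol[OF *(5,2) assms(3)] by simp
qed

text \<open>The least permutation of the class of \<sigma> lies below every \<nu> of that length
  whose inversions contain \<open>forced \<sigma>\<close>. So an arbitrary representative \<nu> of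
  the upper class can be tested.\<close>

lemma baxter_le_iff:
  assumes "\<sigma> \<in> perms" "\<nu> \<in> perms"
  shows "baxter_le (P_symbol \<sigma>) (P_symbol \<nu>) \<longleftrightarrow> length \<sigma> = length \<nu> \<and> forced \<sigma> \<subseteq> inversions \<nu>"
proof
  assume "baxter_le (P_symbol \<sigma>) (P_symbol \<nu>)"
  then show "length \<sigma> = length \<nu> \<and> forced \<sigma> \<subseteq> inversions \<nu>"
    using baxter_le_forced assms forced_subset_inversions by blast
next
  assume *: "length \<sigma> = length \<nu> \<and> forced \<sigma> \<subseteq> inversions \<nu>"
  obtain \<mu> where \<mu>: "\<mu> \<in> perms" "P_symbol \<mu> = P_symbol \<sigma>" "inversions \<mu> = (forced \<sigma>)\<^sup>+"
    using exists_minimal_perm[OF assms(1)] by blast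
  have "length \<mu> = length \<nu>" using length_eq_of_P_symbol_eq[OF \<mu>(2)] * by simp
  then have "permutohedron_le \<mu> \<nu>"
    using \<mu> assms * trancl_forced_subset[of \<sigma> \<nu>]
    by (intro permutohedron_leI) (simp_all add: distinct_perm set_perm)
  then show "baxter_le (P_symbol \<sigma>) (P_symbol \<nu>)"
    unfolding baxter_le_def using \<mu> assms twin_P_symbol by blast
qed

lemma baxter_le_refl: "twin J \<Longrightarrow> baxter_le J J"
  using P_symbol_surj baxter_le_iff forced_subset_inversions by metis

lemma baxter_le_antisym: "\<lbrakk>baxter_le J K; baxter_le K J\<rbrakk> \<Longrightarrow> J = K"
proof -
  assume *: "baxter_le J K" "baxter_le K J"
  then obtain \<sigma> \<nu> where "\<sigma> \<in> perms" "\<nu> \<in> perms" "P_symbol \<sigma> = J" "P_symbol \<nu> = K"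
    unfolding baxter_le_def by blast
  then show "J = K"
    using baxter_le_forced[of \<sigma> \<nu>] baxter_le_forced[of \<nu> \<sigma>] * P_symbol_eq_iff_forced[of \<sigma> \<nu>] by blast
qed

text \<open>The two relations may use different representatives of \<open>K\<close>. Passing to
  \<open>forced\<close>, which depends only on the class, removes the mismatch.\<close>

lemma baxter_le_trans: "\<lbrakk>baxter_le J K; baxter_le K L\<rbrakk> \<Longrightarrow> baxter_le J L"
proof -
  assume *: "baxter_le J K" "baxter_le K L"
  then obtain \<sigma> \<nu> \<rho> where p: "\<sigma> \<in> perms" "\<nu> \<in> perms" "\<rho> \<in> perms"
    and J: "P_symbol \<sigma> = J" "P_symbol \<nu> = K" "P_symbol \<rho> = L"
    unfolding baxter_le_def by blast
  then have "length \<sigma> = length \<rho>" "forced \<sigma> \<subseteq> forced \<rho>"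
    using baxter_le_forced[of \<sigma> \<nu>] baxter_le_forced[of \<nu> \<rho>] * by auto
  then show "baxter_le J L"
    using baxter_le_iff[OF p(1,3)] forced_subset_inversions[of \<rho>] J by blast
qed

section \<open>Concatenation\<close>

lemma length_over [simp]: "length (over \<sigma> \<nu>) = length \<sigma> + length \<nu>"
  by (simp add: over_def)

lemma append_in_shuffles: "xs @ ys \<in> shuffles xs ys"
  by (induction xs) (auto intro: Cons_in_shuffles_leftI)

lemma over_perms:
  assumes "\<sigma> \<in> perms" "\<nu> \<in> perms"
  shows "over \<sigma> \<nu> \<in> perms"
  by (rule shifted_shuffles_perms[OF assms]) (simp add: shifted_shuffles_def over_def append_in_shuffles)

lemma before_shift: "(a, b) \<in> before (shift n w) \<longleftrightarrow> n \<le> a \<and> n \<le> b \<and> (a - n, b - n) \<in> before w"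
proof
  assume "(a, b) \<in> before (shift n w)"
  then show "n \<le> a \<and> n \<le> b \<and> (a - n, b - n) \<in> before w" by (auto simp: shift_def before_map)
next
  assume *: "n \<le> a \<and> n \<le> b \<and> (a - n, b - n) \<in> before w"
  then have "(a, b) = map_prod (\<lambda>i. i + n) (\<lambda>i. i + n) (a - n, b - n)" by simp
  then show "(a, b) \<in> before (shift n w)" unfolding shift_def before_map using * by blast
qed

lemma inversions_over:
  assumes "\<sigma> \<in> perms" "\<nu> \<in> perms"
  shows "(a, b) \<in> inversions (over \<sigma> \<nu>) \<longleftrightarrow> (a, b) \<in> inversions \<sigma> \<or>
    length \<sigma> < a \<and> (a - length \<sigma>, b - length \<sigma>) \<in> inversions \<nu>"
proof -
  have "0 \<notin> set \<nu>" using assms(2) by (simp add: perms_def)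
  then show ?thesis
    using set_perm[OF assms(1)]
    by (auto simp: inversions_def over_def before_append before_shift set_shift dest: before_in_set)
qed

lemma inversions_perm_bounds:
  "\<lbrakk>(a, b) \<in> inversions \<sigma>; \<sigma> \<in> perms\<rbrakk> \<Longrightarrow> 1 \<le> a \<and> a < b \<and> b \<le> length \<sigma>"
  using inversions_subset[of \<sigma>] by (auto simp: perms_def inversions_def)

text \<open>The letters of a permutation fill an interval of integers, so \<open>c\<close> can range
  over all numbers.\<close>

lemma forced_perm_iff:
  assumes "\<sigma> \<in> perms"
  shows "(a, b) \<in> forced \<sigma> \<longleftrightarrow> a < b \<and>
    ((\<forall>c. a \<le> c \<and> c < b \<longrightarrow> (c, b) \<in> inversions \<sigma>) \<or> (\<forall>c. a < c \<and> c \<le> b \<longrightarrow> (a, c) \<in> inversions \<sigma>))"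
proof
  assume "(a, b) \<in> forced \<sigma>"
  then show "a < b \<and> ((\<forall>c. a \<le> c \<and> c < b \<longrightarrow> (c, b) \<in> inversions \<sigma>) \<or>
      (\<forall>c. a < c \<and> c \<le> b \<longrightarrow> (a, c) \<in> inversions \<sigma>))"
    unfolding forced_iff[OF distinct_perm[OF assms]] set_perm[OF assms] by auto
next
  assume *: "a < b \<and> ((\<forall>c. a \<le> c \<and> c < b \<longrightarrow> (c, b) \<in> inversions \<sigma>) \<or>
      (\<forall>c. a < c \<and> c \<le> b \<longrightarrow> (a, c) \<in> inversions \<sigma>))"
  then have "(a, b) \<in> inversions \<sigma>" by auto
  then show "(a, b) \<in> forced \<sigma>"
    using * inversions_subset[of \<sigma>] unfolding forced_iff[OF distinct_perm[OF assms]] by blast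
qed

text \<open>No inversion of a concatenation crosses the cut, and on either side of it the interval
  condition involves only letters of that side.\<close>

lemma forced_over:
  assumes "\<sigma> \<in> perms" "\<nu> \<in> perms"
  shows "(a, b) \<in> forced (over \<sigma> \<nu>) \<longleftrightarrow> (a, b) \<in> forced \<sigma> \<or>
    length \<sigma> < a \<and> (a - length \<sigma>, b - length \<sigma>) \<in> forced \<nu>"
proof (cases "a < b")
  case ab: True
  define n where "n = length \<sigma>"
  note inv = inversions_over[OF assms, folded n_def]
  note forced = forced_perm_iff[OF over_perms[OF assms]]
  note bounds = inversions_perm_bounds[OF _ assms(1), folded n_def] inversions_perm_bounds[OF _ assms(2)]
  consider "b \<le> n" | "n < a" | "a \<le> n" "n < b" using ab by linarith
  then show ?thesis unfolding n_def[symmetric]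
  proof cases
    case 1
    then have "(c, e) \<in> inversions (over \<sigma> \<nu>) \<longleftrightarrow> (c, e) \<in> inversions \<sigma>" if "e \<le> b" for c e
      using that bounds(2)[of "c - n" "e - n"] unfolding inv by auto
    then have "(a, b) \<in> forced (over \<sigma> \<nu>) \<longleftrightarrow> (a, b) \<in> forced \<sigma>"
      unfolding forced forced_perm_iff[OF assms(1)] by auto
    then show "(a, b) \<in> forced (over \<sigma> \<nu>) \<longleftrightarrow> (a, b) \<in> forced \<sigma> \<or> n < a \<and> (a - n, b - n) \<in> forced \<nu>"
      using 1 ab by auto
  next
    case 2
    have i: "(c, e) \<in> inversions (over \<sigma> \<nu>) \<longleftrightarrow> (c - n, e - n) \<in> inversions \<nu>" if "n < c" for c e
      using that bounds(1)[of c e] unfolding inv by auto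
    have e: "(\<forall>c. a \<le> c \<and> c < b \<longrightarrow> (c, b) \<in> inversions (over \<sigma> \<nu>)) \<longleftrightarrow>
        (\<forall>c. a - n \<le> c \<and> c < b - n \<longrightarrow> (c, b - n) \<in> inversions \<nu>)" (is "?L \<longleftrightarrow> ?R")
    proof
      assume L: ?L
      show ?R
      proof (intro allI impI)
        fix c assume "a - n \<le> c \<and> c < b - n"
        then have "a \<le> c + n \<and> c + n < b" by linarith
        then have "(c + n, b) \<in> inversions (over \<sigma> \<nu>)" "n < c + n" using L 2 by auto
        then show "(c, b - n) \<in> inversions \<nu>" using i by simp
      qed
    next
      assume R: ?R
      show ?L
      proof (intro allI impI)
        fix c assume "a \<le> c \<and> c < b"
        then have "a - n \<le> c - n \<and> c - n < b - n" "n < c" using 2 by linarith+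
        then have "(c - n, b - n) \<in> inversions \<nu>" "n < c" using R 2 by auto
        then show "(c, b) \<in> inversions (over \<sigma> \<nu>)" using i by simp
      qed
    qed
    have f: "(\<forall>c. a < c \<and> c \<le> b \<longrightarrow> (a, c) \<in> inversions (over \<sigma> \<nu>)) \<longleftrightarrow>
        (\<forall>c. a - n < c \<and> c \<le> b - n \<longrightarrow> (a - n, c) \<in> inversions \<nu>)" (is "?L \<longleftrightarrow> ?R")
    proof
      assume L: ?L
      show ?R
      proof (intro allI impI)
        fix c assume "a - n < c \<and> c \<le> b - n"
        then have "a < c + n \<and> c + n \<le> b" using ab by linarith
        then have "(a, c + n) \<in> inversions (over \<sigma> \<nu>)" using L by blast
        then show "(a - n, c) \<in> inversions \<nu>" using i 2 by simp
      qed
    next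
      assume R: ?R
      show ?L
      proof (intro allI impI)
        fix c assume "a < c \<and> c \<le> b"
        then have "a - n < c - n \<and> c - n \<le> b - n" using 2 by linarith
        then have "(a - n, c - n) \<in> inversions \<nu>" using R 2 by auto
        then show "(a, c) \<in> inversions (over \<sigma> \<nu>)" using i 2 by simp
      qed
    qed
    have "a - n < b - n" using 2 ab by linarith
    then have "(a, b) \<in> forced (over \<sigma> \<nu>) \<longleftrightarrow> (a - n, b - n) \<in> forced \<nu>"
      unfolding forced forced_perm_iff[OF assms(2)] e f using ab by simp
    moreover have "(a, b) \<notin> forced \<sigma>"
      using 2 bounds(1)[of a b] forced_subset_inversions[of \<sigma>] by auto
    ultimately show "(a, b) \<in> forced (over \<sigma> \<nu>) \<longleftrightarrow> (a, b) \<in> forced \<sigma> \<or> n < a \<and> (a - n, b - n) \<in> forced \<nu>"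
      using 2 by simp
  next
    case 3
    have "(a, b) \<notin> inversions \<sigma>" using 3 bounds(1)[of a b] by auto
    moreover from this have "(a, b) \<notin> inversions (over \<sigma> \<nu>)" using 3 unfolding inv by auto
    ultimately show "(a, b) \<in> forced (over \<sigma> \<nu>) \<longleftrightarrow> (a, b) \<in> forced \<sigma> \<or> n < a \<and> (a - n, b - n) \<in> forced \<nu>"
      using 3 forced_subset_inversions[of \<sigma>] forced_subset_inversions[of "over \<sigma> \<nu>"] by auto
  qed
next
  case False
  then show ?thesis by (auto simp: forced_def)
qed

section \<open>Splitting a permutation by values\<close>

definition low_part :: "nat \<Rightarrow> nat list \<Rightarrow> nat list" where
  "low_part m \<pi> = filter (\<lambda>i. i \<le> m) \<pi>"

definition high_part :: "nat \<Rightarrow> nat list \<Rightarrow> nat list" where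
  "high_part m \<pi> = map (\<lambda>i. i - m) (filter (\<lambda>i. \<not> i \<le> m) \<pi>)"

lemma shift_high_part: "shift m (high_part m \<pi>) = filter (\<lambda>i. \<not> i \<le> m) \<pi>"
  by (induction \<pi>) (auto simp: shift_def high_part_def)

lemma parts_perms:
  assumes "\<pi> \<in> perms" "m \<le> length \<pi>"
  shows "low_part m \<pi> \<in> perms" "length (low_part m \<pi>) = m"
    and "high_part m \<pi> \<in> perms" "length (high_part m \<pi>) = length \<pi> - m"
proof -
  have d: "distinct (low_part m \<pi>)" using assms(1) by (simp add: low_part_def perms_def)
  have s: "set (low_part m \<pi>) = {1..m}"
    using assms by (auto simp: low_part_def perms_def)
  show l: "length (low_part m \<pi>) = m" using distinct_card[OF d] s by simp
  show "low_part m \<pi> \<in> perms" using d s l by (simp add: perms_def)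
  have "length (high_part m \<pi>) = length (filter (\<lambda>i. \<not> i \<le> m) \<pi>)" by (simp add: high_part_def)
  moreover have "length (filter (\<lambda>i. i \<le> m) \<pi>) + length (filter (\<lambda>i. \<not> i \<le> m) \<pi>) = length \<pi>"
    by (rule sum_length_filter_compl)
  ultimately show h: "length (high_part m \<pi>) = length \<pi> - m"
    using l unfolding low_part_def by linarith
  have "distinct (high_part m \<pi>)"
    using assms(1) by (auto simp: high_part_def distinct_map perms_def inj_on_def)
  moreover have "set (high_part m \<pi>) = {1..length \<pi> - m}"
  proof -
    have "set (high_part m \<pi>) = (\<lambda>i. i - m) ` {m + 1..length \<pi>}"
      using assms(1) by (auto simp: high_part_def perms_def intro!: image_eqI)
    also have "\<dots> = {1..length \<pi> - m}"
    proof (rule equalityI)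
      show "{1..length \<pi> - m} \<subseteq> (\<lambda>i. i - m) ` {m + 1..length \<pi>}"
      proof
        fix i assume "i \<in> {1..length \<pi> - m}"
        then show "i \<in> (\<lambda>i. i - m) ` {m + 1..length \<pi>}"
          using assms(2) by (intro image_eqI[of _ _ "i + m"]) auto
      qed
    qed auto
    finally show ?thesis .
  qed
  ultimately show "high_part m \<pi> \<in> perms" using h by (simp add: perms_def)
qed

lemma inversions_filter: "inversions (filter P w) = {(a, b) \<in> inversions w. P a \<and> P b}"
  by (auto simp: inversions_def before_filter)

lemma inversions_shift: "inversions (shift n w) = {(a, b). n \<le> a \<and> (a - n, b - n) \<in> inversions w}"
  by (auto simp: inversions_def before_shift)

text \<open>If no inversion crosses \<open>m\<close>, all letters up to \<open>m\<close> precede all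
  larger ones.\<close>

lemma over_parts:
  assumes "\<pi> \<in> perms" "m \<le> length \<pi>" "\<And>a b. (a, b) \<in> inversions \<pi> \<Longrightarrow> \<not> (a \<le> m \<and> m < b)"
  shows "over (low_part m \<pi>) (high_part m \<pi>) = \<pi>"
proof -
  note p = parts_perms[OF assms(1,2)]
  have "(a, b) \<in> inversions (over (low_part m \<pi>) (high_part m \<pi>)) \<longleftrightarrow> (a, b) \<in> inversions \<pi>" for a b
  proof -
    have "m < a \<and> (a - m, b - m) \<in> inversions (high_part m \<pi>) \<longleftrightarrow>
        m < a \<and> (a, b) \<in> inversions (shift m (high_part m \<pi>))"
      by (auto simp: inversions_shift)
    also have "\<dots> \<longleftrightarrow> (a, b) \<in> inversions \<pi> \<and> m < a \<and> m < b"
      unfolding shift_high_part by (auto simp: inversions_filter)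
    finally show ?thesis
      unfolding inversions_over[OF p(1,3)] p(2) using assms(3)[of a b]
      by (auto simp: low_part_def inversions_filter) (auto simp: inversions_def)
  qed
  then have "inversions (over (low_part m \<pi>) (high_part m \<pi>)) = inversions \<pi>" by auto
  moreover have "over (low_part m \<pi>) (high_part m \<pi>) \<in> perms" using over_perms p by blast
  ultimately show ?thesis
    using assms(1,2) p by (intro inversions_inj) (simp_all add: distinct_perm set_perm)
qed

section \<open>Connected pairs\<close>

text \<open>The pairs not crossing \<open>m\<close> form a transitive relation, so the closure of
  \<open>forced \<sigma>\<close> does not cross \<open>m\<close> either. The least permutation of
  the class therefore splits at \<open>m\<close>.\<close>

lemma not_connected_pair:
  assumes "\<sigma> \<in> perms" "0 < m" "m < length \<sigma>" "\<And>a b. (a, b) \<in> forced \<sigma> \<Longrightarrow> \<not> (a \<le> m \<and> m < b)"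
  shows "\<not> connected_pair (P_symbol \<sigma>)"
proof
  assume c: "connected_pair (P_symbol \<sigma>)"
  obtain \<mu> where \<mu>: "\<mu> \<in> perms" "P_symbol \<mu> = P_symbol \<sigma>" "inversions \<mu> = (forced \<sigma>)\<^sup>+"
    using exists_minimal_perm[OF assms(1)] by blast
  have len: "length \<mu> = length \<sigma>" by (rule length_eq_of_P_symbol_eq[OF \<mu>(2)])
  let ?Q = "{(a, b). \<not> (a \<le> m \<and> m < b)}"
  have "trans ?Q" by (auto simp: trans_def)
  moreover have "forced \<sigma> \<subseteq> ?Q" using assms(4) by auto
  ultimately have "inversions \<mu> \<subseteq> ?Q" unfolding \<mu>(3) using trancl_mono_subset by (metis trancl_id)
  then have "\<not> (a \<le> m \<and> m < b)" if "(a, b) \<in> inversions \<mu>" for a b using that by blast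
  then have "over (low_part m \<mu>) (high_part m \<mu>) = \<mu>"
    using assms(3) len by (intro over_parts[OF \<mu>(1)]) simp_all
  moreover have "connected_perm \<mu>" using c \<mu> by (simp add: connected_pair_def)
  moreover have "low_part m \<mu> \<in> perms" "high_part m \<mu> \<in> perms"
    and "length (low_part m \<mu>) = m" "length (high_part m \<mu>) = length \<mu> - m"
    using parts_perms[OF \<mu>(1), of m] assms(3) len by simp_all
  ultimately show False
    unfolding connected_perm_def using assms(2,3) len by (metis diff_less less_irrefl less_trans)
qed

text \<open>No forced inversion of the common concatenation crosses \<open>length \<sigma>\<close>.
  If \<tau> were longer, this would be a position inside \<tau> at which its pair splits.\<close>

lemma length_le_of_connected_pair:
  assumes "\<sigma> \<in> perms" "\<tau> \<in> perms" "\<rho> \<in> perms" "\<rho>' \<in> perms"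
    and "P_symbol (over \<sigma> \<rho>) = P_symbol (over \<tau> \<rho>')"
    and "\<sigma> \<noteq> []" "connected_pair (P_symbol \<tau>)"
  shows "length \<tau> \<le> length \<sigma>"
proof (rule ccontr)
  assume less: "\<not> length \<tau> \<le> length \<sigma>"
  have f: "forced (over \<sigma> \<rho>) = forced (over \<tau> \<rho>')"
    using forced_P_symbol[OF assms(5)] over_perms assms by blast
  have "\<not> (a \<le> length \<sigma> \<and> length \<sigma> < b)" if "(a, b) \<in> forced \<tau>" for a b
  proof -
    have "(a, b) \<in> forced (over \<sigma> \<rho>)" unfolding f using that forced_over[OF assms(2,4)] by blast
    then have "(a, b) \<in> forced \<sigma> \<or> length \<sigma> < a" using forced_over[OF assms(1,3)] by blast
    then show ?thesis using inversions_perm_bounds[OF _ assms(1)] forced_subset_inversions[of \<sigma>] by force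
  qed
  moreover have "0 < length \<sigma>" "length \<sigma> < length \<tau>" using assms(6) less by simp_all
  ultimately have "\<not> connected_pair (P_symbol \<tau>)" by (intro not_connected_pair[OF assms(2)])
  then show False using assms(7) by contradiction
qed

text \<open>By symmetry the first factors have the same length \<open>n\<close>. Their forced
  inversions are then those of the concatenation with values up to \<open>n\<close>; those of the
  second factors are the ones beyond \<open>n\<close>, shifted back.\<close>

lemma P_symbol_over_cancel:
  assumes perms: "\<sigma> \<in> perms" "\<tau> \<in> perms" "\<rho> \<in> perms" "\<rho>' \<in> perms"
    and eq: "P_symbol (over \<sigma> \<rho>) = P_symbol (over \<tau> \<rho>')"
    and ne: "\<sigma> \<noteq> []" "\<tau> \<noteq> []"
    and conn: "connected_pair (P_symbol \<sigma>)" "connected_pair (P_symbol \<tau>)"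
  shows "P_symbol \<sigma> = P_symbol \<tau>" "P_symbol \<rho> = P_symbol \<rho>'"
proof -
  have len: "length \<sigma> = length \<tau>"
    using length_le_of_connected_pair[OF perms eq ne(1) conn(2)]
      length_le_of_connected_pair[OF perms(2,1,4,3) eq[symmetric] ne(2) conn(1)] by simp
  have len': "length \<rho> = length \<rho>'"
    using length_eq_of_P_symbol_eq[OF eq] len by simp
  have f: "forced (over \<sigma> \<rho>) = forced (over \<tau> \<rho>')"
    using forced_P_symbol[OF eq] over_perms perms by blast
  have bound: "b \<le> length \<pi>" if "(a, b) \<in> forced \<pi>" "\<pi> \<in> perms" for a b \<pi>
    using that forced_subset_inversions[of \<pi>] inversions_perm_bounds[of a b \<pi>] by auto
  have less: "a < b" if "(a, b) \<in> forced \<pi>" for a b :: nat and \<pi> using that by (simp add: forced_def)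
  have "(a, b) \<in> forced \<sigma> \<longleftrightarrow> (a, b) \<in> forced (over \<sigma> \<rho>) \<and> b \<le> length \<sigma>" for a b
    using forced_over[OF perms(1,3), of a b] bound[of a b \<sigma>] perms(1) less[of a b "over \<sigma> \<rho>"] by auto
  moreover have "(a, b) \<in> forced \<tau> \<longleftrightarrow> (a, b) \<in> forced (over \<tau> \<rho>') \<and> b \<le> length \<sigma>" for a b
    using forced_over[OF perms(2,4), of a b] bound[of a b \<tau>] perms(2) less[of a b "over \<tau> \<rho>'"] len by auto
  ultimately have "forced \<sigma> = forced \<tau>" using f by auto
  then show "P_symbol \<sigma> = P_symbol \<tau>" using P_symbol_eq_iff_forced perms len by blast
  have pos: "0 < a" if "(a, b) \<in> forced \<pi>" "\<pi> \<in> perms" for a b \<pi>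
    using that forced_subset_inversions[of \<pi>] inversions_perm_bounds[of a b \<pi>] by auto
  have high: "(a, b) \<in> forced \<pi>' \<longleftrightarrow> 0 < a \<and> (a + length \<pi>, b + length \<pi>) \<in> forced (over \<pi> \<pi>')"
    if "\<pi> \<in> perms" "\<pi>' \<in> perms" for a b \<pi> \<pi>'
    using forced_over[OF that, of "a + length \<pi>" "b + length \<pi>"] bound[of "a + length \<pi>" "b + length \<pi>" \<pi>]
      that pos[of a b \<pi>'] less[of "a + length \<pi>" "b + length \<pi>" \<pi>] by auto
  have "(a, b) \<in> forced \<rho> \<longleftrightarrow> (a, b) \<in> forced \<rho>'" for a b
    using high[OF perms(1,3)] high[OF perms(2,4)] f len by simp
  then have "forced \<rho> = forced \<rho>'" by auto
  then show "P_symbol \<rho> = P_symbol \<rho>'" using P_symbol_eq_iff_forced perms len' by blast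
qed

section \<open>The elementary basis\<close>

lemma Rep_fqsym_sum: "Rep_fqsym (sum h A) = (\<Sum>x\<in>A. Rep_fqsym (h x))"
  for h :: "'b \<Rightarrow> 'k::comm_ring_1 fqsym"
  by (induction A rule: infinite_finite_induct) (simp_all add: zero_fqsym.rep_eq plus_fqsym.rep_eq)

abbreviation coeff :: "'k::zero fqsym \<Rightarrow> nat list \<Rightarrow> 'k" where
  "coeff x \<sigma> \<equiv> Poly_Mapping.lookup (Rep_fqsym x) \<sigma>"

lemma coeff_sum: "coeff (sum h A) \<sigma> = (\<Sum>x\<in>A. coeff (h x) \<sigma>)"
  for h :: "'b \<Rightarrow> 'k::comm_ring_1 fqsym"
  by (simp add: Rep_fqsym_sum lookup_sum)

lemma coeff_scale: "coeff (fqsym_scale c x) \<sigma> = c * coeff x \<sigma>"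
  by (simp add: fqsym_scale.rep_eq)

lemma coeff_F: "\<sigma> \<in> perms \<Longrightarrow> coeff (fqsym_F \<sigma> :: 'k::comm_ring_1 fqsym) \<nu> = (if \<nu> = \<sigma> then 1 else 0)"
  by (auto simp: fqsym_F.rep_eq lookup_single when_def)

definition upper_perms :: "nat list \<Rightarrow> nat list set" where
  "upper_perms \<sigma> = {\<nu> \<in> perms. length \<nu> = length \<sigma> \<and> forced \<sigma> \<subseteq> inversions \<nu>}"

lemma finite_upper_perms: "finite (upper_perms \<sigma>)"
  by (rule finite_subset[OF _ finite_perms_of_length[of "length \<sigma>"]]) (auto simp: upper_perms_def)

lemma upper_perms_iff:
  "\<sigma> \<in> perms \<Longrightarrow> \<nu> \<in> upper_perms \<sigma> \<longleftrightarrow> \<nu> \<in> perms \<and> baxter_le (P_symbol \<sigma>) (P_symbol \<nu>)"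
  using baxter_le_iff by (auto simp: upper_perms_def)

lemma baxter_E_P_symbol:
  assumes "\<sigma> \<in> perms"
  shows "(baxter_E (P_symbol \<sigma>) :: 'k::comm_ring_1 fqsym) = (\<Sum>\<nu>\<in>upper_perms \<sigma>. fqsym_F \<nu>)"
proof -
  have "(baxter_E (P_symbol \<sigma>) :: 'k fqsym) =
      sum fqsym_F (\<Union>J'\<in>{J'. baxter_le (P_symbol \<sigma>) J'}. {\<nu>. \<nu> \<in> perms \<and> P_symbol \<nu> = J'})"
    unfolding baxter_E_def baxter_P_def
    by (rule sum.UNION_disjoint[symmetric]) (use finite_baxter_le finite_P_symbol_fiber in auto)
  also have "(\<Union>J'\<in>{J'. baxter_le (P_symbol \<sigma>) J'}. {\<nu>. \<nu> \<in> perms \<and> P_symbol \<nu> = J'}) = upper_perms \<sigma>"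
    by (rule set_eqI) (auto simp: upper_perms_iff[OF assms])
  finally show ?thesis .
qed

lemma coeff_baxter_E:
  assumes "\<sigma> \<in> perms"
  shows "coeff (baxter_E (P_symbol \<sigma>) :: 'k::comm_ring_1 fqsym) \<nu> = (if \<nu> \<in> upper_perms \<sigma> then 1 else 0)"
proof -
  have "coeff (baxter_E (P_symbol \<sigma>) :: 'k fqsym) \<nu> = (\<Sum>\<pi>\<in>upper_perms \<sigma>. if \<nu> = \<pi> then 1 else 0)"
    unfolding baxter_E_P_symbol[OF assms] coeff_sum
    by (intro sum.cong refl coeff_F) (simp add: upper_perms_def)
  then show ?thesis by (simp add: finite_upper_perms)
qed

text \<open>With \<open>in_shifted_shuffles_parts\<close>: for a given size of the first factor,
  every permutation is a shifted shuffle of exactly one pair. Hence products of distinct basis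
  elements of fixed sizes have disjoint supports.\<close>

lemma shifted_shuffles_parts:
  assumes "\<sigma> \<in> perms" "\<nu> \<in> perms" "\<pi> \<in> shifted_shuffles \<sigma> \<nu>"
  shows "low_part (length \<sigma>) \<pi> = \<sigma>" "high_part (length \<sigma>) \<pi> = \<nu>"
proof -
  let ?n = "length \<sigma>"
  have \<pi>: "\<pi> \<in> shuffles \<sigma> (shift ?n \<nu>)" using assms(3) by (simp add: shifted_shuffles_def)
  have \<pi>p: "\<pi> \<in> perms" using shifted_shuffles_perms assms by blast
  have mem: "i \<le> ?n \<longleftrightarrow> i \<in> set \<sigma>" if "i \<in> set \<pi>" for i
    using that set_perm[OF \<pi>p] set_perm[OF assms(1)] by auto
  note disj = perms_disjoint[OF assms(1,2)]
  show low: "low_part ?n \<pi> = \<sigma>"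
    unfolding low_part_def using filter_shuffles_disjoint1(1)[OF disj \<pi>] mem
    by (simp cong: filter_cong)
  have "filter (\<lambda>i. \<not> i \<le> ?n) \<pi> = shift ?n \<nu>"
    using filter_shuffles_disjoint1(2)[OF disj \<pi>] mem by (simp cong: filter_cong)
  then show "high_part ?n \<pi> = \<nu>"
    unfolding high_part_def by (simp add: shift_def comp_def)
qed

lemma in_shifted_shuffles_parts:
  assumes "\<pi> \<in> perms" "m \<le> length \<pi>"
  shows "\<pi> \<in> shifted_shuffles (low_part m \<pi>) (high_part m \<pi>)"
  unfolding shifted_shuffles_def parts_perms(2)[OF assms] shift_high_part
  unfolding low_part_def by (rule partition_in_shuffles)

text \<open>The forced inversions of the concatenation are those of \<sigma> and the shifted ones of
  \<nu>. The former are tested on the low part of \<pi>, the latter on its high part, and the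
  shuffle is arbitrary otherwise.\<close>

lemma upper_perms_over:
  assumes "\<sigma> \<in> perms" "\<nu> \<in> perms"
  shows "(\<Union>(\<sigma>', \<nu>')\<in>upper_perms \<sigma> \<times> upper_perms \<nu>. shifted_shuffles \<sigma>' \<nu>') = upper_perms (over \<sigma> \<nu>)"
proof -
  let ?n = "length \<sigma>"
  have parts: "forced (over \<sigma> \<nu>) \<subseteq> inversions \<pi> \<longleftrightarrow>
      forced \<sigma> \<subseteq> inversions (low_part ?n \<pi>) \<and> forced \<nu> \<subseteq> inversions (high_part ?n \<pi>)" for \<pi>
  proof -
    have high: "(a, b) \<in> inversions (high_part ?n \<pi>) \<longleftrightarrow> (a + ?n, b + ?n) \<in> inversions \<pi>"
      if "0 < a" for a b
    proof -
      have "(a, b) \<in> inversions (high_part ?n \<pi>) \<longleftrightarrow>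
          (a + ?n, b + ?n) \<in> inversions (shift ?n (high_part ?n \<pi>))"
        by (simp add: inversions_shift)
      also have "\<dots> \<longleftrightarrow> (a + ?n, b + ?n) \<in> inversions \<pi>"
        unfolding shift_high_part using that by (auto simp: inversions_filter) (simp add: inversions_def)
      finally show ?thesis .
    qed
    have f\<sigma>: "b \<le> ?n \<and> a < b" if "(a, b) \<in> forced \<sigma>" for a b
      using that forced_subset_inversions[of \<sigma>] inversions_perm_bounds[OF _ assms(1)] by blast
    have f\<nu>: "0 < a" if "(a, b) \<in> forced \<nu>" for a b
      using that forced_subset_inversions[of \<nu>] inversions_perm_bounds[OF _ assms(2), of a b] by auto
    have "forced (over \<sigma> \<nu>) = forced \<sigma> \<union> (\<lambda>(a, b). (a + ?n, b + ?n)) ` forced \<nu>"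
    proof (rule set_eqI, clarify)
      fix a b
      have "?n < a \<and> (a - ?n, b - ?n) \<in> forced \<nu> \<longleftrightarrow> (a, b) \<in> (\<lambda>(a, b). (a + ?n, b + ?n)) ` forced \<nu>"
      proof
        assume *: "?n < a \<and> (a - ?n, b - ?n) \<in> forced \<nu>"
        then have "a - ?n < b - ?n" by (simp add: forced_def)
        then have "(a, b) = (\<lambda>(a, b). (a + ?n, b + ?n)) (a - ?n, b - ?n)" using * by auto
        then show "(a, b) \<in> (\<lambda>(a, b). (a + ?n, b + ?n)) ` forced \<nu>" using * by blast
      qed (auto dest: f\<nu>)
      then show "(a, b) \<in> forced (over \<sigma> \<nu>) \<longleftrightarrow>
          (a, b) \<in> forced \<sigma> \<union> (\<lambda>(a, b). (a + ?n, b + ?n)) ` forced \<nu>"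
        unfolding forced_over[OF assms] by blast
    qed
    moreover have "forced \<sigma> \<subseteq> inversions (low_part ?n \<pi>) \<longleftrightarrow> forced \<sigma> \<subseteq> inversions \<pi>"
      unfolding low_part_def inversions_filter using f\<sigma> by fastforce
    moreover have "forced \<nu> \<subseteq> inversions (high_part ?n \<pi>) \<longleftrightarrow>
        (\<lambda>(a, b). (a + ?n, b + ?n)) ` forced \<nu> \<subseteq> inversions \<pi>"
      unfolding image_subset_iff subset_eq[of "forced \<nu>"]
    proof (intro ball_cong refl)
      fix p assume "p \<in> forced \<nu>"
      then show "p \<in> inversions (high_part ?n \<pi>) \<longleftrightarrow> (case p of (a, b) \<Rightarrow> (a + ?n, b + ?n)) \<in> inversions \<pi>"
        using f\<nu>[of "fst p" "snd p"] high[of "fst p" "snd p"] by (simp add: case_prod_beta)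
    qed
    ultimately show ?thesis by simp
  qed
  show ?thesis
  proof (intro equalityI subsetI)
    fix \<pi> assume "\<pi> \<in> (\<Union>(\<sigma>', \<nu>')\<in>upper_perms \<sigma> \<times> upper_perms \<nu>. shifted_shuffles \<sigma>' \<nu>')"
    then obtain \<sigma>' \<nu>' where *: "\<sigma>' \<in> upper_perms \<sigma>" "\<nu>' \<in> upper_perms \<nu>" "\<pi> \<in> shifted_shuffles \<sigma>' \<nu>'"
      by blast
    then have p: "\<sigma>' \<in> perms" "\<nu>' \<in> perms" and len: "length \<sigma>' = ?n" "length \<nu>' = length \<nu>"
      by (simp_all add: upper_perms_def)
    have "length \<pi> = ?n + length \<nu>"
      using *(3) len by (auto simp: shifted_shuffles_def dest: length_shuffles)
    then show "\<pi> \<in> upper_perms (over \<sigma> \<nu>)"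
      using shifted_shuffles_perms[OF p *(3)] shifted_shuffles_parts[OF p *(3)] parts *(1,2) len
      by (simp add: upper_perms_def)
  next
    fix \<pi> assume "\<pi> \<in> upper_perms (over \<sigma> \<nu>)"
    then have \<pi>: "\<pi> \<in> perms" "length \<pi> = ?n + length \<nu>" "forced (over \<sigma> \<nu>) \<subseteq> inversions \<pi>"
      by (simp_all add: upper_perms_def)
    then have "low_part ?n \<pi> \<in> upper_perms \<sigma>" "high_part ?n \<pi> \<in> upper_perms \<nu>"
      using parts parts_perms[OF \<pi>(1), of ?n] by (simp_all add: upper_perms_def)
    then show "\<pi> \<in> (\<Union>(\<sigma>', \<nu>')\<in>upper_perms \<sigma> \<times> upper_perms \<nu>. shifted_shuffles \<sigma>' \<nu>')"
      using in_shifted_shuffles_parts[OF \<pi>(1), of ?n] \<pi>(2) by auto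
  qed
qed

lemma baxter_E_mult:
  assumes "\<sigma> \<in> perms" "\<nu> \<in> perms"
  shows "(baxter_E (P_symbol \<sigma>) * baxter_E (P_symbol \<nu>) :: 'k::comm_ring_1 fqsym) =
    baxter_E (P_symbol (over \<sigma> \<nu>))"
proof -
  let ?U = "upper_perms \<sigma> \<times> upper_perms \<nu>"
  have "(baxter_E (P_symbol \<sigma>) * baxter_E (P_symbol \<nu>) :: 'k fqsym) =
      (\<Sum>(\<sigma>', \<nu>')\<in>?U. fqsym_F \<sigma>' * fqsym_F \<nu>')"
    unfolding baxter_E_P_symbol[OF assms(1)] baxter_E_P_symbol[OF assms(2)]
    by (simp add: sum_product sum.cartesian_product)
  also have "\<dots> = (\<Sum>p\<in>?U. \<Sum>\<pi>\<in>(case p of (\<sigma>', \<nu>') \<Rightarrow> shifted_shuffles \<sigma>' \<nu>'). fqsym_F \<pi>)"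
    by (intro sum.cong refl) (auto simp: upper_perms_def fqsym_F_mult)
  also have "\<dots> = sum fqsym_F (\<Union>(\<sigma>', \<nu>')\<in>?U. shifted_shuffles \<sigma>' \<nu>')"
  proof (rule sum.UNION_disjoint[symmetric])
    show "finite ?U" by (simp add: finite_upper_perms)
    show "\<forall>p\<in>?U. finite (case p of (\<sigma>', \<nu>') \<Rightarrow> shifted_shuffles \<sigma>' \<nu>')"
      by (auto simp: shifted_shuffles_def)
    show "\<forall>p\<in>?U. \<forall>q\<in>?U. p \<noteq> q \<longrightarrow>
        (case p of (\<sigma>', \<nu>') \<Rightarrow> shifted_shuffles \<sigma>' \<nu>') \<inter>
        (case q of (\<sigma>', \<nu>') \<Rightarrow> shifted_shuffles \<sigma>' \<nu>') = {}"
    proof (intro ballI impI)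
      fix p q assume pq: "p \<in> ?U" "q \<in> ?U" "p \<noteq> q"
      obtain s t s' t' where p: "p = (s, t)" "q = (s', t')" by (cases p, cases q)
      have perms: "s \<in> perms" "t \<in> perms" "s' \<in> perms" "t' \<in> perms" "length s = length s'"
        using pq p by (simp_all add: upper_perms_def)
      have "s = s' \<and> t = t'" if "\<pi> \<in> shifted_shuffles s t" "\<pi> \<in> shifted_shuffles s' t'" for \<pi>
        using shifted_shuffles_parts[OF perms(1,2) that(1)] shifted_shuffles_parts[OF perms(3,4) that(2)]
        unfolding perms(5) by blast
      then have False if "\<pi> \<in> shifted_shuffles s t" "\<pi> \<in> shifted_shuffles s' t'" for \<pi>
        using that pq(3) p by blast
      then show "(case p of (\<sigma>', \<nu>') \<Rightarrow> shifted_shuffles \<sigma>' \<nu>') \<inter>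
        (case q of (\<sigma>', \<nu>') \<Rightarrow> shifted_shuffles \<sigma>' \<nu>') = {}" using p by auto
    qed
  qed
  also have "\<dots> = baxter_E (P_symbol (over \<sigma> \<nu>))"
    unfolding upper_perms_over[OF assms] by (rule baxter_E_P_symbol[OF over_perms[OF assms], symmetric])
  finally show ?thesis .
qed

lemma baxter_E_Nil: "(baxter_E (P_symbol []) :: 'k::comm_ring_1 fqsym) = 1"
proof -
  have "upper_perms [] = {[]}" by (auto simp: upper_perms_def forced_def first_def)
  then show ?thesis by (simp add: baxter_E_P_symbol one_eq_fqsym_F)
qed

text \<open>The support of \<open>baxter_E J\<close> determines which classes lie above
  \<open>J\<close>. Independence, being a property of a set of vectors, would not exclude
  repetitions in the family.\<close>

lemma inj_on_baxter_E: "inj_on (baxter_E :: _ \<Rightarrow> 'k::comm_ring_1 fqsym) {J. twin J}"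
proof (rule inj_onI)
  fix J K assume JK: "J \<in> {J. twin J}" "K \<in> {J. twin J}" "(baxter_E J :: 'k fqsym) = baxter_E K"
  obtain \<sigma> \<nu> where \<sigma>: "\<sigma> \<in> perms" "P_symbol \<sigma> = J" and \<nu>: "\<nu> \<in> perms" "P_symbol \<nu> = K"
    using P_symbol_surj JK by blast
  have "\<pi> \<in> upper_perms \<sigma> \<longleftrightarrow> \<pi> \<in> upper_perms \<nu>" for \<pi>
    using coeff_baxter_E[OF \<sigma>(1), of \<pi>, where 'k = 'k] coeff_baxter_E[OF \<nu>(1), of \<pi>, where 'k = 'k]
      JK(3) \<sigma>(2) \<nu>(2) by (simp split: if_splits)
  then have "baxter_le J K" "baxter_le K J"
    using upper_perms_iff \<sigma> \<nu> baxter_le_refl JK by blast+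
  then show "J = K" by (rule baxter_le_antisym)
qed

text \<open>Triangularity: let \<open>K\<close> be minimal among the indices with nonzero
  coefficient, and \<sigma> a permutation of class \<open>K\<close>. At \<sigma> only the vectors
  \<open>baxter_E J\<close> with \<open>J\<close> below \<open>K\<close> contribute, so just the one
  with \<open>J = K\<close> does.\<close>

lemma independent_baxter_E:
  "fqsym.independent (baxter_E ` {J. twin J} :: 'k::field fqsym set)"
proof
  assume "fqsym.dependent (baxter_E ` {J. twin J} :: 'k fqsym set)"
  then obtain t u where t: "finite t" "t \<subseteq> baxter_E ` {J. twin J}"
    "(\<Sum>v\<in>t. fqsym_scale (u v) v) = (0 :: 'k fqsym)" "\<exists>v\<in>t. u v \<noteq> 0"
    unfolding fqsym.dependent_explicit by blast
  obtain T where T: "T \<subseteq> {J. twin J}" "finite T" "t = baxter_E ` T"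
    using finite_subset_image[OF t(1,2)] by blast
  have inj: "inj_on (baxter_E :: _ \<Rightarrow> 'k fqsym) T" using inj_on_subset[OF inj_on_baxter_E T(1)] .
  define S where "S = {J \<in> T. u (baxter_E J) \<noteq> 0}"
  have S: "finite S" "S \<noteq> {}" using T(2,3) t(4) by (auto simp: S_def)
  define R where "R J K \<longleftrightarrow> baxter_le J K \<and> J \<noteq> K" for J K
  have "asymp_on S R" using baxter_le_antisym by (auto simp: R_def intro!: asymp_onI)
  moreover have "transp_on S R"
    unfolding R_def using baxter_le_antisym baxter_le_trans by (blast intro: transp_onI)
  ultimately obtain K where K: "K \<in> S" "\<And>J. \<lbrakk>J \<in> S; J \<noteq> K\<rbrakk> \<Longrightarrow> \<not> baxter_le J K"
    using Finite_Set.bex_min_element[OF S(1) _ _ S(2), of R] unfolding R_def by blast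
  have "twin K" using K(1) T(1) by (auto simp: S_def)
  then obtain \<sigma> where \<sigma>: "\<sigma> \<in> perms" "P_symbol \<sigma> = K" using P_symbol_surj by blast
  have "coeff (baxter_E J :: 'k fqsym) \<sigma> = (if baxter_le J K then 1 else 0)" if "J \<in> T" for J
  proof -
    have "twin J" using that T(1) by auto
    then obtain \<nu> where "\<nu> \<in> perms" "P_symbol \<nu> = J" using P_symbol_surj by blast
    then show ?thesis using coeff_baxter_E[of \<nu> \<sigma>] upper_perms_iff[of \<nu> \<sigma>] \<sigma> by simp
  qed
  then have "(\<Sum>J\<in>T. coeff (fqsym_scale (u (baxter_E J)) (baxter_E J)) \<sigma>) =
      (\<Sum>J\<in>T. if J = K then u (baxter_E K) else 0)"
    using K baxter_le_refl[of K] T(1) by (intro sum.cong refl) (auto simp: coeff_scale S_def)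
  also have "\<dots> = u (baxter_E K)" using T(2) K(1) by (simp add: S_def)
  finally have "(\<Sum>J\<in>T. coeff (fqsym_scale (u (baxter_E J)) (baxter_E J)) \<sigma>) = u (baxter_E K)" .
  moreover have "(\<Sum>J\<in>T. fqsym_scale (u (baxter_E J)) (baxter_E J)) = 0"
    using t(3) unfolding T(3) sum.reindex[OF inj] by simp
  then have "(\<Sum>J\<in>T. coeff (fqsym_scale (u (baxter_E J)) (baxter_E J)) \<sigma>) = 0"
    unfolding coeff_sum[symmetric] by (simp add: zero_fqsym.rep_eq)
  ultimately show False using K(1) by (simp add: S_def)
qed

lemma baxter_le_twin: "baxter_le J K \<Longrightarrow> twin J \<and> twin K"
  by (simp add: baxter_le_def)

text \<open>The triangular system is solved from the top of the order downwards, by induction on the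
  number of pairs above \<open>J\<close>.\<close>

lemma span_baxter_E: "fqsym.span (baxter_E ` {J. twin J}) = (Baxter :: 'k::field fqsym set)"
proof -
  have P: "(baxter_P J :: 'k fqsym) \<in> fqsym.span (baxter_E ` {J. twin J})" if "twin J" for J
    using that
  proof (induction "card {K. baxter_le J K}" arbitrary: J rule: less_induct)
    case less
    define U where "U = {K. baxter_le J K}"
    have finU: "finite U" unfolding U_def by (rule finite_baxter_le(1))
    have J: "J \<in> U" using baxter_le_refl less.prems by (simp add: U_def)
    have "(baxter_P K :: 'k fqsym) \<in> fqsym.span (baxter_E ` {J. twin J})" if K: "K \<in> U - {J}" for K
    proof -
      have "{L. baxter_le K L} \<subset> U"
        using K J baxter_le_trans baxter_le_antisym unfolding U_def by blast
      then have "card {L. baxter_le K L} < card U"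
        by (rule psubset_card_mono[OF finU])
      then show ?thesis using less.hyps K baxter_le_twin unfolding U_def by blast
    qed
    moreover have "(baxter_P J :: 'k fqsym) = baxter_E J - (\<Sum>K\<in>U - {J}. baxter_P K)"
      unfolding baxter_E_def U_def[symmetric] using sum.remove[OF finU J, of "baxter_P :: _ \<Rightarrow> 'k fqsym"] by simp
    ultimately show ?case
      using less.prems
      by (auto intro!: fqsym.span_diff fqsym.span_sum intro: fqsym.span_base)
  qed
  have "(baxter_E J :: 'k fqsym) \<in> Baxter" for J
    unfolding Baxter_def baxter_E_def
    by (intro fqsym.span_sum fqsym.span_base imageI) (simp add: baxter_le_twin)
  then show ?thesis using P unfolding Baxter_def
    by (intro fqsym.span_eq[THEN iffD2] conjI) auto
qed

section \<open>Freeness\<close>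

lemma free_eval_superset:
  assumes "finite K" "Poly_Mapping.keys p \<subseteq> K"
  shows "free_eval fqsym_scale x p =
    (\<Sum>w\<in>K. fqsym_scale (Poly_Mapping.lookup p w) (prod_list (map x w)))"
  unfolding free_eval_def using assms
  by (intro sum.mono_neutral_left) (auto simp: in_keys_iff)

text \<open>The evaluation is the linear map sending words to monomials. It is bijective onto
  \<open>A\<close> when the monomials form a basis of \<open>A\<close> without repetitions, which is
  why \<open>inj\<close> accompanies \<open>ind\<close>.\<close>

lemma free_onI:
  fixes x :: "'i \<Rightarrow> 'k::field fqsym"
  defines "b \<equiv> \<lambda>w. prod_list (map x w)"
  assumes inj: "inj_on b (lists I)"
    and ind: "fqsym.independent (b ` lists I)"
    and span: "fqsym.span (b ` lists I) = A"
  shows "free_on fqsym_scale A x I"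
proof -
  let ?D = "{p. Poly_Mapping.keys p \<subseteq> lists I}"
  have "inj_on (free_eval fqsym_scale x) ?D"
  proof (rule inj_onI)
    fix p q :: "'i list \<Rightarrow>\<^sub>0 'k"
    assume pq: "p \<in> ?D" "q \<in> ?D" "free_eval fqsym_scale x p = free_eval fqsym_scale x q"
    define K where "K = Poly_Mapping.keys p \<union> Poly_Mapping.keys q"
    have K: "finite K" "K \<subseteq> lists I" "Poly_Mapping.keys p \<subseteq> K" "Poly_Mapping.keys q \<subseteq> K"
      using pq by (auto simp: K_def)
    have injK: "inj_on b K" using inj_on_subset[OF inj K(2)] .
    let ?c = "\<lambda>w. Poly_Mapping.lookup p w - Poly_Mapping.lookup q w"
    have "(\<Sum>w\<in>K. fqsym_scale (?c w) (b w)) = 0"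
      using pq(3) free_eval_superset[OF K(1,3), of x] free_eval_superset[OF K(1,4), of x]
      by (simp add: fqsym.scale_left_diff_distrib sum_subtractf b_def)
    then have "(\<Sum>v\<in>b ` K. fqsym_scale (?c (inv_into K b v)) v) = 0"
      using injK by (simp add: sum.reindex)
    then have zero: "?c (inv_into K b v) = 0" if "v \<in> b ` K" for v
      using fqsym.independentD[OF ind, of "b ` K" "\<lambda>v. ?c (inv_into K b v)"] K(1,2) that by blast
    have "?c w = 0" if "w \<in> K" for w
      using zero[of "b w"] that injK by simp
    moreover have "?c w = 0" if "w \<notin> K" for w using that by (simp add: K_def in_keys_iff)
    ultimately show "p = q" by (intro poly_mapping_eqI) (metis eq_iff_diff_eq_0)
  qed
  moreover have "free_eval fqsym_scale x ` ?D = fqsym.span (b ` lists I)"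
  proof (intro equalityI subsetI)
    fix v assume "v \<in> free_eval fqsym_scale x ` ?D"
    then obtain p where p: "Poly_Mapping.keys p \<subseteq> lists I" "v = free_eval fqsym_scale x p" by blast
    have "fqsym_scale (Poly_Mapping.lookup p w) (prod_list (map x w)) \<in> fqsym.span (b ` lists I)"
      if "w \<in> Poly_Mapping.keys p" for w
      using that p(1) unfolding b_def by (intro fqsym.span_scale fqsym.span_base) blast
    then show "v \<in> fqsym.span (b ` lists I)" by (simp add: p(2) free_eval_def fqsym.span_sum)
  next
    fix v assume "v \<in> fqsym.span (b ` lists I)"
    then obtain t r where t: "finite t" "t \<subseteq> b ` lists I" "v = (\<Sum>a\<in>t. fqsym_scale (r a) a)"
      unfolding fqsym.span_explicit by blast
    obtain K where K: "K \<subseteq> lists I" "finite K" "t = b ` K"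
      using finite_subset_image[OF t(1,2)] by blast
    define p where "p = (\<Sum>w\<in>K. Poly_Mapping.single w (r (b w)))"
    have lp: "Poly_Mapping.lookup p w = (if w \<in> K then r (b w) else 0)" for w
      using K(2) by (simp add: p_def lookup_sum lookup_single when_def)
    then have keys: "Poly_Mapping.keys p \<subseteq> K" by (auto simp: in_keys_iff split: if_splits)
    have "v = (\<Sum>w\<in>K. fqsym_scale (r (b w)) (b w))"
      unfolding t(3) K(3) using inj_on_subset[OF inj K(1)] by (simp add: sum.reindex)
    also have "\<dots> = free_eval fqsym_scale x p"
      unfolding free_eval_superset[OF K(2) keys] by (intro sum.cong refl) (simp add: lp b_def)
    finally show "v \<in> free_eval fqsym_scale x ` ?D" using keys K(1) by blast
  qed
  ultimately show ?thesis unfolding free_on_def bij_betw_def using span by simp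
qed

section \<open>Unique factorization into connected pairs\<close>

definition rep_perm :: "tree_pair \<Rightarrow> nat list" where
  "rep_perm J = (SOME \<sigma>. \<sigma> \<in> perms \<and> P_symbol \<sigma> = J)"

lemma rep_perm: "twin J \<Longrightarrow> rep_perm J \<in> perms" "twin J \<Longrightarrow> P_symbol (rep_perm J) = J"
  unfolding rep_perm_def using P_symbol_surj by (metis (mono_tags, lifting) someI_ex)+

text \<open>The choice of representatives is immaterial: by \<open>forced_over\<close> the tree pair
  of a concatenation depends only on those of its factors.\<close>

fun word_perm :: "tree_pair list \<Rightarrow> nat list" where
  "word_perm [] = []"
| "word_perm (J # w) = over (rep_perm J) (word_perm w)"

text \<open>The empty permutation satisfies \<open>connected_perm\<close>, so the pair of empty
  trees must be excluded explicitly: its \<open>baxter_E\<close> is the unit.\<close>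

abbreviation connected_pairs :: "tree_pair set" where
  "connected_pairs \<equiv> {J. twin J \<and> J \<noteq> (Leaf, Leaf) \<and> connected_pair J}"

lemma P_symbol_eq_Leaf_iff: "P_symbol \<sigma> = (Leaf, Leaf) \<longleftrightarrow> \<sigma> = []"
proof
  assume "P_symbol \<sigma> = (Leaf, Leaf)"
  then have "length \<sigma> = 0" using size_P_symbol(1)[of \<sigma>] by simp
  then show "\<sigma> = []" by simp
qed (simp add: P_symbol_def bst_of_def shape_def)

lemma word_perm_perms: "w \<in> lists connected_pairs \<Longrightarrow> word_perm w \<in> perms"
  by (induction w) (auto simp: over_perms rep_perm)

lemma prod_list_baxter_E:
  "w \<in> lists connected_pairs \<Longrightarrow>
     prod_list (map baxter_E w) = (baxter_E (P_symbol (word_perm w)) :: 'k::comm_ring_1 fqsym)"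
proof (induction w)
  case Nil
  then show ?case by (simp add: baxter_E_Nil)
next
  case (Cons J w)
  then have J: "twin J" and w: "w \<in> lists connected_pairs" by auto
  then show ?case
    using baxter_E_mult[OF rep_perm(1)[OF J] word_perm_perms[OF w], where 'k = 'k] Cons.IH[OF w]
    by (simp add: rep_perm(2)[OF J])
qed

lemma rep_perm_neq_Nil: "J \<in> connected_pairs \<Longrightarrow> rep_perm J \<noteq> []"
  using rep_perm(2)[of J] P_symbol_eq_Leaf_iff[of "[]"] by (metis (mono_tags, lifting) mem_Collect_eq)

text \<open>Uniqueness of the factorization: \<open>P_symbol_over_cancel\<close> removes one factor
  at a time, and nonempty factors keep the empty word apart.\<close>

lemma P_symbol_word_perm_inj:
  "\<lbrakk>w \<in> lists connected_pairs; w' \<in> lists connected_pairs;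
    P_symbol (word_perm w) = P_symbol (word_perm w')\<rbrakk> \<Longrightarrow> w = w'"
proof (induction w arbitrary: w')
  case Nil
  have "length (word_perm w') = 0" using length_eq_of_P_symbol_eq[OF Nil(3)] by simp
  then show ?case using Nil(2) rep_perm_neq_Nil by (cases w') (simp_all add: over_def)
next
  case (Cons J w)
  have J: "J \<in> connected_pairs" and w: "w \<in> lists connected_pairs" using Cons.prems(1) by simp_all
  have "w' \<noteq> []"
  proof
    assume "w' = []"
    then have "length (word_perm (J # w)) = 0"
      using length_eq_of_P_symbol_eq[OF Cons.prems(3)] by simp
    then show False using rep_perm_neq_Nil[OF J] by simp
  qed
  then obtain K v where w': "w' = K # v" by (cases w') simp_all
  have K: "K \<in> connected_pairs" and v: "v \<in> lists connected_pairs" using Cons.prems(2) w' by simp_all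
  have twins: "twin J" "twin K" and conn: "connected_pair J" "connected_pair K" using J K by simp_all
  note rep = rep_perm[OF twins(1)] rep_perm[OF twins(2)]
  have eq: "P_symbol (over (rep_perm J) (word_perm w)) = P_symbol (over (rep_perm K) (word_perm v))"
    using Cons.prems(3) w' by simp
  have "connected_pair (P_symbol (rep_perm J))" "connected_pair (P_symbol (rep_perm K))"
    using conn rep by simp_all
  note cancel = P_symbol_over_cancel[OF rep(1,3) word_perm_perms[OF w] word_perm_perms[OF v] eq
    rep_perm_neq_Nil[OF J] rep_perm_neq_Nil[OF K] this]
  then show ?case using Cons.IH[OF w v] w' rep(2,4) by simp
qed

text \<open>If the pair is not connected, some permutation \<tau> of the class, not necessarily
  \<sigma>, is a proper concatenation; \<open>baxter_E_mult\<close> splits the vector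
  accordingly.\<close>

lemma baxter_E_factorization:
  assumes "\<sigma> \<in> perms"
  shows "\<exists>w\<in>lists connected_pairs.
    prod_list (map baxter_E w) = (baxter_E (P_symbol \<sigma>) :: 'k::comm_ring_1 fqsym)"
  using assms
proof (induction "length \<sigma>" arbitrary: \<sigma> rule: less_induct)
  case less
  show ?case
  proof (cases "\<sigma> = [] \<or> connected_pair (P_symbol \<sigma>)")
    case True
    then consider "\<sigma> = []" | "P_symbol \<sigma> \<in> connected_pairs"
      using twin_P_symbol[OF less.prems] P_symbol_eq_Leaf_iff by blast
    then show ?thesis
    proof cases
      case 1
      then show ?thesis by (intro bexI[of _ "[]"]) (simp_all add: baxter_E_Nil)
    next
      case 2
      then show ?thesis by (intro bexI[of _ "[P_symbol \<sigma>]"]) simp_all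
    qed
  next
    case False
    then obtain \<tau> where \<tau>: "\<tau> \<in> perms" "P_symbol \<tau> = P_symbol \<sigma>" "\<not> connected_perm \<tau>"
      by (auto simp: connected_pair_def)
    then obtain \<nu> \<pi> where *: "\<nu> \<in> perms" "\<pi> \<in> perms" "\<tau> = over \<nu> \<pi>" "\<nu> \<noteq> \<tau>" "\<pi> \<noteq> \<tau>"
      by (auto simp: connected_perm_def)
    have "\<nu> \<noteq> []" "\<pi> \<noteq> []" using *(3-5) by (auto simp: over_def shift_def)
    moreover have "length \<sigma> = length \<nu> + length \<pi>"
      using length_eq_of_P_symbol_eq[OF \<tau>(2)] *(3) by simp
    ultimately have "length \<nu> < length \<sigma>" "length \<pi> < length \<sigma>" by simp_all
    note shorter = this
    obtain u where u: "u \<in> lists connected_pairs"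
      "prod_list (map baxter_E u) = (baxter_E (P_symbol \<nu>) :: 'k fqsym)"
      using less.hyps[OF shorter(1) *(1)] by blast
    obtain v where v: "v \<in> lists connected_pairs"
      "prod_list (map baxter_E v) = (baxter_E (P_symbol \<pi>) :: 'k fqsym)"
      using less.hyps[OF shorter(2) *(2)] by blast
    have "prod_list (map baxter_E (u @ v)) = (baxter_E (P_symbol \<sigma>) :: 'k fqsym)"
      using baxter_E_mult[OF *(1,2), where 'k = 'k] unfolding \<tau>(2)[symmetric] *(3)
      by (simp add: u(2) v(2))
    moreover have "u @ v \<in> lists connected_pairs" using u(1) v(1) by simp
    ultimately show ?thesis by blast
  qed
qed

text \<open>The monomials in the generators are the whole family \<open>E\<close>, each member once;
  its being a basis is therefore the freeness claim.\<close>

lemma monomials_baxter_E: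
  "inj_on (\<lambda>w. prod_list (map baxter_E w) :: 'k::comm_ring_1 fqsym) (lists connected_pairs)"
  "(\<lambda>w. prod_list (map baxter_E w) :: 'k fqsym) ` lists connected_pairs = baxter_E ` {J. twin J}"
proof -
  show "inj_on (\<lambda>w. prod_list (map baxter_E w) :: 'k fqsym) (lists connected_pairs)"
  proof (rule inj_onI)
    fix w w' assume w: "w \<in> lists connected_pairs" "w' \<in> lists connected_pairs"
      and "(prod_list (map baxter_E w) :: 'k fqsym) = prod_list (map baxter_E w')"
    then have "(baxter_E (P_symbol (word_perm w)) :: 'k fqsym) = baxter_E (P_symbol (word_perm w'))"
      by (simp add: prod_list_baxter_E)
    then have "P_symbol (word_perm w) = P_symbol (word_perm w')"
      using inj_onD[OF inj_on_baxter_E] twin_P_symbol word_perm_perms w by blast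
    then show "w = w'" using P_symbol_word_perm_inj w by blast
  qed
  show "(\<lambda>w. prod_list (map baxter_E w) :: 'k fqsym) ` lists connected_pairs = baxter_E ` {J. twin J}"
  proof (intro equalityI subsetI)
    fix x assume "x \<in> (\<lambda>w. prod_list (map baxter_E w) :: 'k fqsym) ` lists connected_pairs"
    then obtain w where w: "w \<in> lists connected_pairs" "x = prod_list (map baxter_E w)" by blast
    show "x \<in> baxter_E ` {J. twin J}"
      unfolding w(2) prod_list_baxter_E[OF w(1)]
      using twin_P_symbol[OF word_perm_perms[OF w(1)]] by blast
  next
    fix x assume "x \<in> (baxter_E ` {J. twin J} :: 'k fqsym set)"
    then obtain \<sigma> where "\<sigma> \<in> perms" "x = baxter_E (P_symbol \<sigma>)" using P_symbol_surj by blast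
    then show "x \<in> (\<lambda>w. prod_list (map baxter_E w) :: 'k fqsym) ` lists connected_pairs"
      using baxter_E_factorization[of \<sigma>, where 'k = 'k] by (metis (no_types, lifting) image_eqI)
  qed
qed

section \<open>The mirror image automorphism\<close>

lemma rev_in_shuffles: "zs \<in> shuffles xs ys \<Longrightarrow> rev zs \<in> shuffles (rev xs) (rev ys)"
proof -
  have snoc: "zs @ [z] \<in> shuffles (xs @ [z]) ys \<and> zs @ [z] \<in> shuffles xs (ys @ [z])"
    if "zs \<in> shuffles xs ys" for zs xs ys :: "'a list" and z
    using that
  proof (induction zs arbitrary: xs ys)
    case (Cons x zs)
    from Cons.prems consider (left) xs' where "xs = x # xs'" "zs \<in> shuffles xs' ys"
      | (right) ys' where "ys = x # ys'" "zs \<in> shuffles xs ys'"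
      by (auto simp: Cons_in_shuffles_iff neq_Nil_conv)
    then show ?case
    proof cases
      case left
      then show ?thesis using Cons.IH[OF left(2)] by (auto intro: Cons_in_shuffles_leftI)
    next
      case right
      then show ?thesis using Cons.IH[OF right(2)] by (auto intro: Cons_in_shuffles_rightI)
    qed
  qed (auto intro: Cons_in_shuffles_leftI Cons_in_shuffles_rightI)
  show "zs \<in> shuffles xs ys \<Longrightarrow> rev zs \<in> shuffles (rev xs) (rev ys)"
  proof (induction xs ys arbitrary: zs rule: shuffles.induct)
    case (3 x xs y ys)
    then show ?case using snoc by fastforce
  qed simp_all
qed

lemma shuffles_rev: "shuffles (rev xs) (rev ys) = rev ` shuffles xs ys"
  using rev_in_shuffles[of _ xs ys] rev_in_shuffles[of _ "rev xs" "rev ys"]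
  by (auto intro: image_eqI[where x = "rev _"])

text \<open>Reversal acts on positions and the shift on values, so they commute. The factors keep
  their order: the mirror map is an automorphism, not an anti-automorphism.\<close>

lemma shifted_shuffles_rev: "shifted_shuffles (rev \<sigma>) (rev \<nu>) = rev ` shifted_shuffles \<sigma> \<nu>"
  by (simp add: shifted_shuffles_def shift_def rev_map[symmetric] shuffles_rev)

lemma map_key_rev_sum:
  "Poly_Mapping.map_key rev (sum h A) = (\<Sum>x\<in>A. Poly_Mapping.map_key rev (h x))"
  for h :: "'b \<Rightarrow> 'a list \<Rightarrow>\<^sub>0 'k::comm_ring_1"
  by (rule poly_mapping_eqI) (simp add: Poly_Mapping.map_key.rep_eq lookup_sum)

lemma map_key_rev_single:
  "Poly_Mapping.map_key rev (Poly_Mapping.single \<sigma> c) = Poly_Mapping.single (rev \<sigma>) c"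
  using map_key_single[of rev "rev \<sigma>" c] by simp

lemma map_key_rev_mult:
  "Poly_Mapping.map_key rev (shuffle_mult f g) =
     shuffle_mult (Poly_Mapping.map_key rev f) (Poly_Mapping.map_key rev g)"
proof -
  have keys: "Poly_Mapping.keys (Poly_Mapping.map_key rev h) = rev ` Poly_Mapping.keys h"
    for h :: "nat list \<Rightarrow>\<^sub>0 'a"
    unfolding keys_map_key[OF inj_on_rev] by (auto intro: image_eqI[where x = "rev _"])
  show ?thesis
    unfolding shuffle_mult_def keys
    by (simp add: sum.reindex map_key_rev_sum map_key_rev_single shifted_shuffles_rev
        Poly_Mapping.map_key.rep_eq)
qed

text \<open>\<open>map_key rev\<close> composes the coefficient function with \<open>rev\<close>; as
  \<open>rev\<close> is an involution, this moves the basis vector of \<sigma> to that of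
  \<open>rev \<sigma>\<close>.\<close>

lift_definition fqsym_mirror :: "'k::comm_ring_1 fqsym \<Rightarrow> 'k fqsym" is "Poly_Mapping.map_key rev"
  by (auto simp: keys_map_key)

lemma fqsym_mirror_mirror [simp]: "fqsym_mirror (fqsym_mirror x) = x"
  by transfer (rule poly_mapping_eqI, simp add: Poly_Mapping.map_key.rep_eq)

lemma fqsym_mirror_mult: "fqsym_mirror (x * y) = fqsym_mirror x * fqsym_mirror y"
  by transfer (rule map_key_rev_mult)

lemma fqsym_mirror_one: "fqsym_mirror 1 = 1"
  by transfer (simp add: map_key_rev_single)

lemma fqsym_mirror_F: "fqsym_mirror (fqsym_F \<sigma>) = fqsym_F (rev \<sigma>)"
  by transfer (auto simp: map_key_rev_single)

lemma fqsym_mirror_add: "fqsym_mirror (x + y) = fqsym_mirror x + fqsym_mirror y"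
  by transfer (simp add: map_key_plus)

lemma fqsym_mirror_scale: "fqsym_mirror (fqsym_scale c x) = fqsym_scale c (fqsym_mirror x)"
  by transfer (rule poly_mapping_eqI, simp add: Poly_Mapping.map_key.rep_eq)

lemma fqsym_mirror_sum: "fqsym_mirror (sum h A) = (\<Sum>x\<in>A. fqsym_mirror (h x))"
  by (rule additive.sum) (simp add: additive_def fqsym_mirror_add)

lemma fqsym_mirror_prod_list: "fqsym_mirror (prod_list xs) = prod_list (map fqsym_mirror xs)"
  by (induction xs) (simp_all add: fqsym_mirror_one fqsym_mirror_mult)

lemma P_symbol_rev: "P_symbol (rev \<sigma>) = prod.swap (P_symbol \<sigma>)"
  by (simp add: P_symbol_def)

lemma fqsym_mirror_baxter_P: "fqsym_mirror (baxter_P J) = baxter_P (prod.swap J)"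
proof -
  have "{\<sigma>. \<sigma> \<in> perms \<and> P_symbol \<sigma> = prod.swap J} = rev ` {\<sigma>. \<sigma> \<in> perms \<and> P_symbol \<sigma> = J}"
    by (force simp: P_symbol_rev intro: image_eqI[where x = "rev _"])
  then show ?thesis by (simp add: baxter_P_def fqsym_mirror_sum fqsym_mirror_F sum.reindex)
qed

lemma twin_swap [simp]: "twin (prod.swap J) \<longleftrightarrow> twin J"
  by (auto simp: twin_def)

text \<open>Reversing a word turns an ascent into a descent. This reversal of the order is what
  exchanges sums over upper sets with sums over lower sets, that is \<open>E\<close> with
  \<open>H\<close>.\<close>

lemma permutohedron_le_rev: "permutohedron_le \<sigma> \<nu> \<Longrightarrow> permutohedron_le (rev \<nu>) (rev \<sigma>)"
  unfolding permutohedron_le_def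
proof (induction rule: rtranclp_induct)
  case (step \<pi> \<rho>)
  have "permutohedron_cover (rev \<rho>) (rev \<pi>)"
    using step(2) by cases (use permutohedron_cover.intros in fastforce)
  then show ?case using step.IH by (rule converse_rtranclp_into_rtranclp)
qed simp

lemma baxter_le_swap: "baxter_le J K \<Longrightarrow> baxter_le (prod.swap K) (prod.swap J)"
  unfolding baxter_le_def using permutohedron_le_rev P_symbol_rev rev_perms twin_swap by metis

lemma fqsym_mirror_baxter_E: "fqsym_mirror (baxter_E J) = baxter_H (prod.swap J)"
proof -
  have "{K. baxter_le K (prod.swap J)} = prod.swap ` {K. baxter_le J K}"
  proof (intro equalityI subsetI)
    fix K assume "K \<in> {K. baxter_le K (prod.swap J)}"
    then have "baxter_le J (prod.swap K)" using baxter_le_swap[of K "prod.swap J"] by simp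
    then show "K \<in> prod.swap ` {K. baxter_le J K}" by (intro image_eqI[of _ _ "prod.swap K"]) simp_all
  qed (auto dest: baxter_le_swap)
  then show ?thesis
    by (simp add: baxter_E_def baxter_H_def fqsym_mirror_sum fqsym_mirror_baxter_P sum.reindex)
qed

lemma anticonnected_pair_swap: "anticonnected_pair (prod.swap J) \<longleftrightarrow> connected_pair J"
  unfolding anticonnected_pair_def connected_pair_def anticonnected_perm_def
  by (metis P_symbol_rev rev_perms rev_rev_ident swap_swap)

theorem theorem6p11:
  "free_on fqsym_scale (Baxter :: 'k::field_char_0 fqsym set) baxter_E
     {J. twin J \<and> J \<noteq> (Leaf, Leaf) \<and> connected_pair J} \<and>
   free_on fqsym_scale (Baxter :: 'k fqsym set) baxter_H
     {J. twin J \<and> J \<noteq> (Leaf, Leaf) \<and> anticonnected_pair J}"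
proof
  note E = monomials_baxter_E[where 'k = 'k]
  show "free_on fqsym_scale (Baxter :: 'k fqsym set) baxter_E connected_pairs"
    by (rule free_onI) (simp_all add: E independent_baxter_E span_baxter_E)
  let ?A = "{J. twin J \<and> J \<noteq> (Leaf, Leaf) \<and> anticonnected_pair J}"
  have A: "?A = prod.swap ` connected_pairs"
  proof (intro equalityI subsetI)
    fix J assume "J \<in> ?A"
    then have "prod.swap J \<in> connected_pairs"
      using anticonnected_pair_swap[of "prod.swap J"] twin_swap[of J] by (cases J) auto
    then show "J \<in> prod.swap ` connected_pairs" by (intro image_eqI[of _ _ "prod.swap J"]) simp_all
  next
    fix J assume "J \<in> prod.swap ` connected_pairs"
    then obtain K where "J = prod.swap K" "K \<in> connected_pairs" by blast
    then show "J \<in> ?A" using anticonnected_pair_swap[of K] twin_swap[of K] by (cases K) auto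
  qed
  interpret vector_space_pair "fqsym_scale :: 'k \<Rightarrow> 'k fqsym \<Rightarrow> 'k fqsym" fqsym_scale
    by unfold_locales
  have lin: "Vector_Spaces.linear fqsym_scale fqsym_scale (fqsym_mirror :: 'k fqsym \<Rightarrow> 'k fqsym)"
    by unfold_locales (simp_all add: fqsym_mirror_add fqsym_mirror_scale)
  have inj: "inj (fqsym_mirror :: 'k fqsym \<Rightarrow> 'k fqsym)" by (metis injI fqsym_mirror_mirror)
  let ?e = "\<lambda>w. prod_list (map baxter_E w) :: 'k fqsym" and ?h = "\<lambda>w. prod_list (map baxter_H w) :: 'k fqsym"
  have h: "?h (map prod.swap w) = fqsym_mirror (?e w)" for w
    by (simp add: fqsym_mirror_prod_list comp_def fqsym_mirror_baxter_E)
  have lists: "lists ?A = map prod.swap ` lists connected_pairs"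
    unfolding A by (rule lists_image)
  have "?h ` lists ?A = fqsym_mirror ` ?e ` lists connected_pairs"
    unfolding lists image_image h ..
  also have "\<dots> = fqsym_mirror ` baxter_E ` {J. twin J}" unfolding E(2) ..
  finally have img: "?h ` lists ?A = fqsym_mirror ` baxter_E ` {J. twin J}" .
  \<comment> \<open>The mirror map permutes the vectors \<open>baxter_P J\<close> by exchanging the
    two trees, so it maps their span onto itself.\<close>
  have "fqsym_mirror ` (Baxter :: 'k fqsym set) = Baxter"
  proof -
    have "fqsym_mirror ` baxter_P ` {J. twin J} = (baxter_P ` {J. twin J} :: 'k fqsym set)"
    proof -
      have "prod.swap ` {J. twin J} = {J. twin J}"
      proof (intro equalityI subsetI)
        fix J :: tree_pair assume "J \<in> {J. twin J}"
        then show "J \<in> prod.swap ` {J. twin J}" by (intro image_eqI[of _ _ "prod.swap J"]) simp_all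
      next
        fix J :: tree_pair assume "J \<in> prod.swap ` {J. twin J}"
        then obtain K where "J = prod.swap K" "twin K" by blast
        then show "J \<in> {J. twin J}" by simp
      qed
      then have "(baxter_P ` {J. twin J} :: 'k fqsym set) = baxter_P ` prod.swap ` {J. twin J}" by simp
      then show ?thesis unfolding image_image fqsym_mirror_baxter_P by simp
    qed
    then show ?thesis unfolding Baxter_def using linear_span_image[OF lin] by metis
  qed
  then have span: "fqsym.span (?h ` lists ?A) = Baxter"
    unfolding img linear_span_image[OF lin] span_baxter_E .
  have ind: "fqsym.independent (?h ` lists ?A)"
    unfolding img by (rule linear_independent_injective_image[OF lin independent_baxter_E])
      (rule inj_on_subset[OF inj subset_UNIV])
  have "inj_on ?h (lists ?A)"
    unfolding lists
  proof (rule inj_on_imageI)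
    show "inj_on (?h \<circ> map prod.swap) (lists connected_pairs)"
      unfolding comp_def h using inj E(1) by (auto simp: inj_on_def)
  qed
  then show "free_on fqsym_scale (Baxter :: 'k fqsym set) baxter_H ?A"
    using ind span by (rule free_onI)
qed

end
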